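(* Let $m=p+q$, write $\mathbb R^m=\mathbb R^p\oplus\mathbb R^q$, $x=u+v$ with $u\in\mathbb R^p$, $v\in\mathbb R^q$, and let $s,k,i\in\mathbb N$. Let $P_k(u)\in\mathcal M_k(\mathbb R^p,\mathbb C_p)$ and $Q_i(v)\in\mathcal M_i(\mathbb R^q,\mathbb C_q)$. Then $$P_M\big(|u|^{2s}P_k(u)Q_i(v)\big)=\frac{\big(2(s+k+i)+m-2\big)P_H\big(|u|^{2s}P_k(u)Q_i(v)\big)-2s\,P_H\big(|u|^{2s-2}u\,P_k'(u)\,v\,Q_i(v)\big)}{2(2s+k+i)+m-2},$$ $$P_M\big(u|u|^{2s}P_k(u)Q_i(v)\big)=\frac{(2s+m-p+2i)\,P_H\big(|u|^{2s}u\,P_k(u)Q_i(v)\big)-(p+2s+2k)\,P_H\big(|u|^{2s}P_k'(u)\,v\,Q_i(v)\big)}{2(2s+1+k+i)+m-2}.$$ The Fischer inner products (squared norms) are given by $$\big\|P_M\big(|u|^{2s}P_k(u)Q_i(v)\big)\big\|_m^2=\frac{2(s+k+i)+m-2}{2(2s+k+i)+m-2}\,c(s,k,i,p,q)\,\|P_k(u)\|_p^2\,\|Q_i(v)\|_q^2,$$ $$\big\|P_M\big(u|u|^{2s}P_k(u)Q_i(v)\big)\big\|_m^2=\frac{c(s+1,k,i,p,q)}{2(s+1)}\,\|P_k(u)\|_p^2\,\|Q_i(v)\|_q^2,$$ where $$c(s,k,i,p,q)=4^s\,s!\,\frac{(k+\frac p2)_s\,(i+\frac q2)_s}{(s+k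+i+\frac{m-2}2)_s}.$$
   Context: $\mathbb N=\{0,1,2,\dots\}$. $\mathbb C_m$ is the complex Clifford algebra generated by $e_1,\dots,e_m$ with $e_ie_j+e_je_i=-2\delta_{ij}$; $\mathbb C_p$ is the subalgebra generated by $e_1,\dots,e_p$ (a basis of $\mathbb R^p$) and $\mathbb C_q$ the subalgebra generated by $e_{p+1},\dots,e_m$ (a basis of $\mathbb R^q$). All products are in $\mathbb C_m$; vectors $u,v,x$ are identified with elements of the Clifford algebra, e.g. $x=\sum_jx_je_j$. $a\mapsto a'$ is the main involution, the algebra automorphism with $e_j'=-e_j$; $P_k'(u)=(P_k(u))'$. When $s=0$ the term with prefactor $2s$ is absent. $\mathcal P(\mathbb R^d,\mathbb C_d)$ is the space of $\mathbb C_d$-valued polynomials; $\mathcal M_k(\mathbb R^d,\mathbb C_d)$ is the space of those which are homogeneous of degree $k$ and monogenic, i.e. annihilated by the Dirac operator $\sum_je_j\partial_{x_j}$ of $\mathbb R^d$ acting from the left; $\mathcal M(\mathbb R^d,\mathbb C_d)$ is the space of all monogenic polynomials, and $\mathcal H(\mathbb R^m,\mathbb C_m)$ the space of $\mathbb C_m$-valued harmonic polynomials. $P_H$ and $P_M$ are the projections of $\mathcal P(\mathbb R^m,\mathbb C_m)$ onto the $s=0$ summands of the Fischer decompositions $\mathcal P(\mathbb R^m,\mathbb C_m)=\bigoplus_{s\ge0}|x|^{2s}\mathcal H(\mathbb R^m,\mathbb C_m)$ and $\mathcal P(\mathbb R^m,\mathbb C_m)=\bigoplus_{s\ge0}x^s\mathcal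 M(\mathbb R^m,\mathbb C_m)$ respectively. $(a)_s=a(a+1)\cdots(a+s-1)$, $(a)_0=1$. The Fischer inner product of $P=\sum_AP_A(x)e_A$ and $Q$ in $\mathcal P(\mathbb R^d,\mathbb C_d)$ is $\langle P,Q\rangle_d=[\bar P(\partial_x)Q(x)]_0|_{x=0}$, where $[\cdot]_0$ is the scalar part and $\bar P(\partial_x)=\sum_A\overline{P_A}(\partial_{x_1},\dots,\partial_{x_d})\bar e_A$, with $\overline{P_A}$ having complex conjugated coefficients and $\bar{\cdot}$ on $e_A$ the anti-involution with $\bar e_j=-e_j$; $\|P\|_d^2=\langle P,P\rangle_d$.
   Formalization: The first and third formulas are stated only when the denominator 2(2s+k+i)+m-2 is nonzero; for p,q ≥ 1 this leaves out only p=q=1, s=k=i=0, where the fraction is 0/0. *)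

theory Defs
  imports "HOL-Library.Poly_Mapping" "HOL-Library.FSet" Complex_Main
begin

section \<open>The complex Clifford algebra\<close>

text \<open>
  One type holds the complex Clifford algebra on generators \<open>e\<^sub>j\<close>, \<open>j :: nat\<close>.  Its elements are
  the finite complex combinations of the basis blades \<open>e\<^sub>A = e\<^bsub>j\<^sub>1\<^esub> \<cdots> e\<^bsub>j\<^sub>r\<^esub>\<close>, where
  \<open>A = {j\<^sub>1 < \<dots> < j\<^sub>r}\<close> is a finite set.  The algebra generated by the \<open>e\<^sub>j\<close> with \<open>j \<in> J\<close> is the
  subalgebra \<open>clifford_on J\<close> below.
\<close>

typedef clifford = "UNIV :: (nat fset \<Rightarrow>\<^sub>0 complex) set"
  morphisms coeffs Clifford by simp

setup_lifting type_definition_clifford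

definition sdiff :: "nat fset \<Rightarrow> nat fset \<Rightarrow> nat fset" where
  "sdiff A B = (A |-| B) |\<union>| (B |-| A)"

text \<open>
  \<open>e\<^sub>A e\<^sub>B = blade_sign A B \<cdot> e\<^bsub>A \<triangle> B\<^esub>\<close>: a pair \<open>b < a\<close> contributes a sign by anticommutation, and a
  pair \<open>b = a\<close> contributes one because \<open>e\<^sub>a\<^sup>2 = - 1\<close>.
\<close>

definition blade_sign :: "nat fset \<Rightarrow> nat fset \<Rightarrow> complex" where
  "blade_sign A B = (- 1) ^ card {(a, b). a |\<in>| A \<and> b |\<in>| B \<and> b \<le> a}"

lift_definition blade :: "nat fset \<Rightarrow> clifford" is "\<lambda>A. Poly_Mapping.single A 1" .

lift_definition cscalar :: "complex \<Rightarrow> clifford" is "\<lambda>c. Poly_Mapping.single {||} c" .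

definition gen :: "nat \<Rightarrow> clifford" where
  "gen j = blade {|j|}"

definition clifford_on :: "nat set \<Rightarrow> clifford set" where
  "clifford_on J = {a. \<forall>A\<in>Poly_Mapping.keys (coeffs a). fset A \<subseteq> J}"

definition cmult :: "(nat fset \<Rightarrow>\<^sub>0 complex) \<Rightarrow> (nat fset \<Rightarrow>\<^sub>0 complex) \<Rightarrow> (nat fset \<Rightarrow>\<^sub>0 complex)" where
  "cmult a b = (\<Sum>A\<in>Poly_Mapping.keys a. \<Sum>B\<in>Poly_Mapping.keys b.
     Poly_Mapping.single (sdiff A B) (blade_sign A B * Poly_Mapping.lookup a A * Poly_Mapping.lookup b B))"

lemma fset_sdiff: "fset (sdiff A B) = (fset A - fset B) \<union> (fset B - fset A)"
  by (auto simp: sdiff_def)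

lemma sdiff_assoc: "sdiff (sdiff A B) C = sdiff A (sdiff B C)"
  by (auto simp: sdiff_def)

lemma sdiff_commute: "sdiff A B = sdiff B A"
  by (auto simp: sdiff_def)

lemma sdiff_empty [simp]: "sdiff {||} A = A" "sdiff A {||} = A"
  by (auto simp: sdiff_def)

lemma blade_sign_prod:
  "blade_sign A B = (\<Prod>a\<in>fset A. \<Prod>b\<in>fset B. if b \<le> a then - 1 else 1)"
proof -
  let ?S = "{(a, b). a |\<in>| A \<and> b |\<in>| B \<and> b \<le> a}"
  have "(\<Prod>a\<in>fset A. \<Prod>b\<in>fset B. if b \<le> a then - 1 else (1::complex))
      = (\<Prod>x\<in>fset A \<times> fset B. if snd x \<le> fst x then - 1 else 1)"
    by (subst prod.cartesian_product) (simp add: case_prod_beta)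
  also have "\<dots> = (\<Prod>x\<in>(fset A \<times> fset B) \<inter> {x. snd x \<le> fst x}. - 1)"
    by (subst prod.If_cases) auto
  also have "(fset A \<times> fset B) \<inter> {x. snd x \<le> fst x} = ?S"
    by auto
  finally show ?thesis
    by (simp add: blade_sign_def)
qed

lemma prod_symdiff:
  fixes f :: "'a \<Rightarrow> complex"
  assumes "finite A" "finite B" and sq: "\<And>x. f x * f x = 1"
  shows "(\<Prod>x\<in>(A - B) \<union> (B - A). f x) = (\<Prod>x\<in>A. f x) * (\<Prod>x\<in>B. f x)"
proof -
  have 1: "prod f A = prod f (A - B) * prod f (A \<inter> B)"
    using assms(1) by (subst prod.union_disjoint[symmetric]) (auto intro: prod.cong)
  have 2: "prod f B = prod f (B - A) * prod f (A \<inter> B)"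
    using assms(2) by (subst prod.union_disjoint[symmetric]) (auto intro: prod.cong)
  have 3: "prod f (A \<inter> B) * prod f (A \<inter> B) = 1"
    by (subst prod.distrib[symmetric]) (simp add: sq)
  have "prod f ((A - B) \<union> (B - A)) = prod f (A - B) * prod f (B - A)"
    using assms by (subst prod.union_disjoint) auto
  also have "\<dots> = prod f (A - B) * prod f (B - A) * (prod f (A \<inter> B) * prod f (A \<inter> B))"
    by (simp add: 3)
  finally show ?thesis
    by (simp add: 1 2 mult_ac)
qed

lemma blade_sign_sdiff_left: "blade_sign (sdiff A B) C = blade_sign A C * blade_sign B C"
  unfolding blade_sign_prod fset_sdiff
  by (rule prod_symdiff) (auto simp: prod.distrib[symmetric] intro!: prod.neutral)

lemma blade_sign_sdiff_right: "blade_sign A (sdiff B C) = blade_sign A B * blade_sign A C"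
proof -
  have "(\<Prod>b\<in>fset (sdiff B C). if b \<le> a then - 1 else (1::complex))
      = (\<Prod>b\<in>fset B. if b \<le> a then - 1 else 1) * (\<Prod>b\<in>fset C. if b \<le> a then - 1 else 1)" for a
    unfolding fset_sdiff by (rule prod_symdiff) auto
  then show ?thesis
    by (simp add: blade_sign_prod prod.distrib)
qed

lemma blade_sign_empty [simp]: "blade_sign {||} A = 1" "blade_sign A {||} = 1"
  by (simp_all add: blade_sign_prod)

lemma blade_sign_sq: "blade_sign A B * blade_sign A B = 1"
  by (simp add: blade_sign_def power_mult_distrib[symmetric])

lemma cmult_superset:
  assumes "finite S" "finite T" "Poly_Mapping.keys a \<subseteq> S" "Poly_Mapping.keys b \<subseteq> T"
  shows "cmult a b = (\<Sum>A\<in>S. \<Sum>B\<in>T.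
     Poly_Mapping.single (sdiff A B) (blade_sign A B * Poly_Mapping.lookup a A * Poly_Mapping.lookup b B))"
proof -
  have "cmult a b = (\<Sum>A\<in>Poly_Mapping.keys a. \<Sum>B\<in>T.
     Poly_Mapping.single (sdiff A B) (blade_sign A B * Poly_Mapping.lookup a A * Poly_Mapping.lookup b B))"
    unfolding cmult_def using assms
    by (intro sum.cong refl sum.mono_neutral_left) (auto simp: in_keys_iff)
  also have "\<dots> = (\<Sum>A\<in>S. \<Sum>B\<in>T.
     Poly_Mapping.single (sdiff A B) (blade_sign A B * Poly_Mapping.lookup a A * Poly_Mapping.lookup b B))"
    using assms by (intro sum.mono_neutral_left) (auto simp: in_keys_iff)
  finally show ?thesis .
qed

lemma cmult_add_left: "cmult (a + b) c = cmult a c + cmult b c"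
proof -
  define S where "S = Poly_Mapping.keys a \<union> Poly_Mapping.keys b"
  have S: "finite S" "Poly_Mapping.keys a \<subseteq> S" "Poly_Mapping.keys b \<subseteq> S" "Poly_Mapping.keys (a + b) \<subseteq> S"
    using Poly_Mapping.keys_add[of a b] by (auto simp: S_def)
  show ?thesis
    by (simp add: cmult_superset[OF S(1) finite_keys S(2) order_refl]
        cmult_superset[OF S(1) finite_keys S(3) order_refl]
        cmult_superset[OF S(1) finite_keys S(4) order_refl]
        lookup_add algebra_simps single_add sum.distrib)
qed

lemma cmult_add_right: "cmult c (a + b) = cmult c a + cmult c b"
proof -
  define S where "S = Poly_Mapping.keys a \<union> Poly_Mapping.keys b"
  have S: "finite S" "Poly_Mapping.keys a \<subseteq> S" "Poly_Mapping.keys b \<subseteq> S" "Poly_Mapping.keys (a + b) \<subseteq> S"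
    using Poly_Mapping.keys_add[of a b] by (auto simp: S_def)
  show ?thesis
    by (simp add: cmult_superset[OF finite_keys S(1) order_refl S(2)]
        cmult_superset[OF finite_keys S(1) order_refl S(3)]
        cmult_superset[OF finite_keys S(1) order_refl S(4)]
        lookup_add algebra_simps single_add sum.distrib)
qed

lemma cmult_single:
  "cmult (Poly_Mapping.single A x) (Poly_Mapping.single B y)
     = Poly_Mapping.single (sdiff A B) (blade_sign A B * x * y)"
  by (subst cmult_superset[of "{A}" "{B}"]) auto

lemma poly_mapping_add_single_induct [case_names zero single]:
  fixes a :: "'a \<Rightarrow>\<^sub>0 'b::comm_monoid_add"
  assumes "P 0" and step: "\<And>a k v. P a \<Longrightarrow> P (a + Poly_Mapping.single k v)"
  shows "P a"
proof -
  have sum: "a = (\<Sum>k\<in>Poly_Mapping.keys a. Poly_Mapping.single k (Poly_Mapping.lookup a k))"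
    by (rule poly_mapping_eqI) (auto simp: lookup_sum lookup_single when_def in_keys_iff)
  have "P (\<Sum>k\<in>K. Poly_Mapping.single k (Poly_Mapping.lookup a k))" if "finite K" for K
    using that
  proof induction
    case (insert k K)
    then show ?case
      using step[of "\<Sum>k\<in>K. Poly_Mapping.single k (Poly_Mapping.lookup a k)" k "Poly_Mapping.lookup a k"]
      by (simp add: add.commute)
  qed (simp add: assms)
  then show ?thesis
    by (subst sum) simp
qed

lemma cmult_zero [simp]: "cmult 0 a = 0" "cmult a 0 = 0"
  by (simp_all add: cmult_def)

lemma cmult_assoc: "cmult (cmult a b) c = cmult a (cmult b c)"
proof (induction a rule: poly_mapping_add_single_induct)
  case (single a A x)
  have "cmult (cmult (Poly_Mapping.single A x) b) c = cmult (Poly_Mapping.single A x) (cmult b c)"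
  proof (induction b rule: poly_mapping_add_single_induct)
    case (single b B y)
    have "cmult (cmult (Poly_Mapping.single A x) (Poly_Mapping.single B y)) c
        = cmult (Poly_Mapping.single A x) (cmult (Poly_Mapping.single B y) c)"
      by (induction c rule: poly_mapping_add_single_induct)
        (auto simp: cmult_add_right cmult_single sdiff_assoc blade_sign_sdiff_left
          blade_sign_sdiff_right mult_ac)
    with single show ?case
      by (simp add: cmult_add_left cmult_add_right)
  qed simp
  with single show ?case
    by (simp add: cmult_add_left)
qed simp

lemma cmult_one:
  "cmult (Poly_Mapping.single {||} 1) a = a" "cmult a (Poly_Mapping.single {||} 1) = a"
  by (induction a rule: poly_mapping_add_single_induct)
    (auto simp: cmult_add_left cmult_add_right cmult_single)

instantiation clifford :: ring_1
begin

lift_definition zero_clifford :: clifford is 0 .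
lift_definition one_clifford :: clifford is "Poly_Mapping.single {||} 1" .
lift_definition plus_clifford :: "clifford \<Rightarrow> clifford \<Rightarrow> clifford" is "(+)" .
lift_definition minus_clifford :: "clifford \<Rightarrow> clifford \<Rightarrow> clifford" is "(-)" .
lift_definition uminus_clifford :: "clifford \<Rightarrow> clifford" is uminus .
lift_definition times_clifford :: "clifford \<Rightarrow> clifford \<Rightarrow> clifford" is cmult .

instance
proof
  show "(0::clifford) \<noteq> 1"
    by transfer (metis lookup_single_eq lookup_zero zero_neq_one)
qed (transfer; simp add: cmult_assoc cmult_add_left cmult_add_right cmult_one algebra_simps; fail)+

end

lemma gen_anticommute: "gen i * gen j + gen j * gen i = cscalar (if i = j then - 2 else 0)"
proof -
  have s: "blade_sign {|i|} {|j|} = (if j \<le> i then - 1 else 1)" for i j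
    by (simp add: blade_sign_prod)
  show ?thesis
  proof (cases "i = j")
    case True
    have "sdiff {|j|} {|j|} = {||}" by (simp add: sdiff_def)
    with True show ?thesis
      unfolding gen_def by transfer (simp add: cmult_single s single_add[symmetric])
  next
    case False
    then show ?thesis
      unfolding gen_def
      by transfer (auto simp: cmult_single s sdiff_commute single_add[symmetric])
  qed
qed

lemma blade_finsert:
  assumes "\<And>b. b |\<in>| B \<Longrightarrow> a < b"
  shows "blade (finsert a B) = gen a * blade B"
proof -
  have "blade_sign {|a|} B = 1"
    using assms by (auto simp: blade_sign_prod intro!: prod.neutral dest: assms)
  moreover have "sdiff {|a|} B = finsert a B"
    using assms by (fastforce simp: sdiff_def)
  ultimately show ?thesis
    unfolding gen_def by transfer (simp add: cmult_single)
qed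

subsection \<open>Main involution, conjugation, scalar part\<close>

definition main_sign :: "nat fset \<Rightarrow> complex" where
  "main_sign A = (- 1) ^ fcard A"

definition conj_sign :: "nat fset \<Rightarrow> complex" where
  "conj_sign A = (- 1) ^ (fcard A * (fcard A + 1) div 2)"

lift_definition main_inv :: "clifford \<Rightarrow> clifford" is
  "\<lambda>a. \<Sum>A\<in>Poly_Mapping.keys a. Poly_Mapping.single A (main_sign A * Poly_Mapping.lookup a A)" .

text \<open>
  The conjugation of \<open>\<complex>\<^sub>m\<close>, conjugate linear in the complex coefficients and reversing products;
  on blades \<open>\<bar>e\<^sub>A\<bar> = (- 1)\<^bsup>r(r+1)/2\<^esup> e\<^sub>A\<close> with \<open>r = |A|\<close>.
\<close>

lift_definition clifford_conj :: "clifford \<Rightarrow> clifford" is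
  "\<lambda>a. \<Sum>A\<in>Poly_Mapping.keys a. Poly_Mapping.single A (conj_sign A * cnj (Poly_Mapping.lookup a A))" .

lift_definition scalar_part :: "clifford \<Rightarrow> complex" is "\<lambda>a. Poly_Mapping.lookup a {||}" .

section \<open>Clifford-valued polynomials\<close>

text \<open>
  Polynomials in commuting real variables \<open>x\<^sub>j\<close> (\<open>j :: nat\<close>) with Clifford coefficients; the
  variables commute with the coefficients.  A Euclidean space with coordinates \<open>x\<^sub>j\<close>, \<open>j \<in> J\<close>, is
  represented by the finite index set \<open>J\<close>, so that \<open>\<real>\<^sup>p\<close>, \<open>\<real>\<^sup>q\<close> and \<open>\<real>\<^sup>m = \<real>\<^sup>p \<oplus> \<real>\<^sup>q\<close> correspond to
  \<open>{1..p}\<close>, \<open>{p+1..p+q}\<close> and \<open>{1..p+q}\<close>.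
\<close>

type_synonym cpoly = "(nat \<Rightarrow>\<^sub>0 nat) \<Rightarrow>\<^sub>0 clifford"

definition cpoly_on :: "nat set \<Rightarrow> cpoly set" where
  "cpoly_on J = {P. \<forall>\<alpha>\<in>Poly_Mapping.keys P. Poly_Mapping.keys \<alpha> \<subseteq> J \<and> Poly_Mapping.lookup P \<alpha> \<in> clifford_on J}"

definition cconst :: "clifford \<Rightarrow> cpoly" where
  "cconst a = Poly_Mapping.single 0 a"

definition cscale :: "complex \<Rightarrow> cpoly \<Rightarrow> cpoly" where
  "cscale c P = cconst (cscalar c) * P"

definition homogeneous :: "nat \<Rightarrow> cpoly \<Rightarrow> bool" where
  "homogeneous k P \<longleftrightarrow> (\<forall>\<alpha>\<in>Poly_Mapping.keys P. (\<Sum>j\<in>Poly_Mapping.keys \<alpha>. Poly_Mapping.lookup \<alpha> j) = k)"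

definition partial :: "nat \<Rightarrow> cpoly \<Rightarrow> cpoly" where
  "partial j P = (\<Sum>\<alpha>\<in>Poly_Mapping.keys P.
     Poly_Mapping.single (\<alpha> - Poly_Mapping.single j 1) (of_nat (Poly_Mapping.lookup \<alpha> j) * Poly_Mapping.lookup P \<alpha>))"

definition dirac :: "nat set \<Rightarrow> cpoly \<Rightarrow> cpoly" where
  "dirac J P = (\<Sum>j\<in>J. cconst (gen j) * partial j P)"

definition laplace :: "nat set \<Rightarrow> cpoly \<Rightarrow> cpoly" where
  "laplace J P = (\<Sum>j\<in>J. partial j (partial j P))"

definition monogenics :: "nat set \<Rightarrow> cpoly set" where
  "monogenics J = {P \<in> cpoly_on J. dirac J P = 0}"

definition monogenics_deg :: "nat \<Rightarrow> nat set \<Rightarrow> cpoly set" where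
  "monogenics_deg k J = {P \<in> monogenics J. homogeneous k P}"

definition harmonics :: "nat set \<Rightarrow> cpoly set" where
  "harmonics J = {P \<in> cpoly_on J. laplace J P = 0}"

definition vec :: "nat set \<Rightarrow> cpoly" where
  "vec J = (\<Sum>j\<in>J. Poly_Mapping.single (Poly_Mapping.single j 1) (gen j))"

definition norm_sq :: "nat set \<Rightarrow> cpoly" where
  "norm_sq J = (\<Sum>j\<in>J. Poly_Mapping.single (Poly_Mapping.single j 2) 1)"

definition cpoly_inv :: "cpoly \<Rightarrow> cpoly" where
  "cpoly_inv P = (\<Sum>\<alpha>\<in>Poly_Mapping.keys P. Poly_Mapping.single \<alpha> (main_inv (Poly_Mapping.lookup P \<alpha>)))"

subsection \<open>Projections in the Fischer decompositions\<close>

text \<open>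
  The \<open>s = 0\<close> component \<open>g 0\<close> of \<open>f\<close> in \<open>\<Oplus>\<^sub>s |x|\<^bsup>2s\<^esup> \<H>\<close> and in \<open>\<Oplus>\<^sub>s x\<^sup>s \<M>\<close>, respectively.  It is unique
  because both sums are direct and exhaust \<open>cpoly_on J\<close>.
\<close>

definition proj_H :: "nat set \<Rightarrow> cpoly \<Rightarrow> cpoly" where
  "proj_H J f = (THE h. \<exists>g N. (\<forall>s. g s \<in> harmonics J) \<and>
     f = (\<Sum>s\<le>N. norm_sq J ^ s * g s) \<and> h = g 0)"

definition proj_M :: "nat set \<Rightarrow> cpoly \<Rightarrow> cpoly" where
  "proj_M J f = (THE h. \<exists>g N. (\<forall>s. g s \<in> monogenics J) \<and>
     f = (\<Sum>s\<le>N. vec J ^ s * g s) \<and> h = g (0::nat))"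

subsection \<open>Fischer inner product\<close>

definition multi_partial :: "(nat \<Rightarrow>\<^sub>0 nat) \<Rightarrow> cpoly \<Rightarrow> cpoly" where
  "multi_partial \<alpha> Q = foldr (\<lambda>j. partial j ^^ Poly_Mapping.lookup \<alpha> j) (sorted_list_of_set (Poly_Mapping.keys \<alpha>)) Q"

text \<open>
  The operator \<open>P\<bar>(\<partial>\<^sub>x)\<close> only involves the variables occurring in \<open>P\<close>, so the formula below gives
  \<open>\<langle>P, Q\<rangle>\<^sub>d\<close> for every \<open>d\<close>.  Evaluation at \<open>x = 0\<close> is the coefficient of the monomial \<open>x\<^sup>0\<close>.
\<close>

definition fischer_inner :: "cpoly \<Rightarrow> cpoly \<Rightarrow> complex" where
  "fischer_inner P Q = scalar_part (Poly_Mapping.lookup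
     (\<Sum>\<alpha>\<in>Poly_Mapping.keys P. cconst (clifford_conj (Poly_Mapping.lookup P \<alpha>)) * multi_partial \<alpha> Q) 0)"

abbreviation fischer_norm_sq :: "cpoly \<Rightarrow> complex" where
  "fischer_norm_sq P \<equiv> fischer_inner P P"

definition fischer_c :: "nat \<Rightarrow> nat \<Rightarrow> nat \<Rightarrow> nat \<Rightarrow> nat \<Rightarrow> real" where
  "fischer_c s k i p q = 4 ^ s * fact s *
     (pochhammer (real k + real p / 2) s * pochhammer (real i + real q / 2) s /
      pochhammer (real s + real k + real i + (real (p + q) - 2) / 2) s)"

subsection \<open>The involutions are determined by their values on generators\<close>

lemma lookup_sum_single:
  assumes "finite K"
  shows "Poly_Mapping.lookup (\<Sum>k\<in>K. Poly_Mapping.single k (f k)) x = (if x \<in> K then f x else 0)"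
  using assms by (simp add: lookup_sum lookup_single when_def sum.delta)

lemma lookup_main_inv: "Poly_Mapping.lookup (coeffs (main_inv a)) A = main_sign A * Poly_Mapping.lookup (coeffs a) A"
  by transfer (simp add: lookup_sum_single in_keys_iff)

lemma lookup_clifford_conj:
  "Poly_Mapping.lookup (coeffs (clifford_conj a)) A = conj_sign A * cnj (Poly_Mapping.lookup (coeffs a) A)"
  by transfer (simp add: lookup_sum_single in_keys_iff)

lemma clifford_eqI: "(\<And>A. Poly_Mapping.lookup (coeffs a) A = Poly_Mapping.lookup (coeffs b) A) \<Longrightarrow> a = b"
  by transfer (rule poly_mapping_eqI)

lemma coeffs_simps:
  "coeffs (a + b) = coeffs a + coeffs b" "coeffs (a * b) = cmult (coeffs a) (coeffs b)"
  "coeffs 0 = 0" "coeffs (cscalar c) = Poly_Mapping.single {||} c"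
  "coeffs (blade A) = Poly_Mapping.single A 1" "coeffs (- a) = - coeffs a"
  by (transfer; simp)+

lemma main_inv_add: "main_inv (a + b) = main_inv a + main_inv b"
  by (rule clifford_eqI) (simp add: lookup_main_inv coeffs_simps lookup_add algebra_simps)

lemma clifford_conj_add: "clifford_conj (a + b) = clifford_conj a + clifford_conj b"
  by (rule clifford_eqI) (simp add: lookup_clifford_conj coeffs_simps lookup_add algebra_simps)

lemma main_inv_zero [simp]: "main_inv 0 = 0"
  by (rule clifford_eqI) (simp add: lookup_main_inv coeffs_simps)

lemma clifford_conj_zero [simp]: "clifford_conj 0 = 0"
  by (rule clifford_eqI) (simp add: lookup_clifford_conj coeffs_simps)

lemma main_inv_scalar: "main_inv (cscalar c) = cscalar c"
  by (rule clifford_eqI)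
    (auto simp: lookup_main_inv coeffs_simps lookup_single when_def main_sign_def fcard.rep_eq)

lemma clifford_conj_scalar: "clifford_conj (cscalar c) = cscalar (cnj c)"
  by (rule clifford_eqI)
    (auto simp: lookup_clifford_conj coeffs_simps lookup_single when_def conj_sign_def fcard.rep_eq)

lemma main_inv_gen: "main_inv (gen j) = - gen j"
  by (rule clifford_eqI)
    (auto simp: lookup_main_inv gen_def coeffs_simps lookup_single when_def main_sign_def fcard.rep_eq)

lemma clifford_conj_gen: "clifford_conj (gen j) = - gen j"
  by (rule clifford_eqI)
    (auto simp: lookup_clifford_conj gen_def coeffs_simps lookup_single when_def conj_sign_def fcard.rep_eq)

lemma main_sign_prod: "main_sign A = (\<Prod>a\<in>fset A. - 1)"
  by (simp add: main_sign_def fcard.rep_eq)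

lemma main_sign_sdiff: "main_sign (sdiff A B) = main_sign A * main_sign B"
  unfolding main_sign_prod fset_sdiff by (rule prod_symdiff) auto

lemma conj_sign_eq: "conj_sign A = blade_sign A A"
proof -
  have *: "card {(a, b). a \<in> S \<and> b \<in> S \<and> b \<le> a} = card S * (card S + 1) div 2"
    if "finite S" for S :: "nat set"
    using that
  proof (induction S rule: finite_linorder_max_induct)
    case (insert m S)
    have m: "m \<notin> S" using insert.hyps by blast
    have "{(a, b). a \<in> insert m S \<and> b \<in> insert m S \<and> b \<le> a}
        = {(a, b). a \<in> S \<and> b \<in> S \<and> b \<le> a} \<union> Pair m ` insert m S"
      using insert.hyps(2) by force
    moreover have "finite {(a, b). a \<in> S \<and> b \<in> S \<and> b \<le> a}"
      by (rule finite_subset[of _ "S \<times> S"]) (use insert.hyps in auto)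
    moreover have "{(a, b). a \<in> S \<and> b \<in> S \<and> b \<le> a} \<inter> Pair m ` insert m S = {}"
      using m by auto
    moreover have "card (Pair m ` insert m S) = card S + 1"
      using m insert.hyps(1) by (subst card_image) (auto simp: inj_on_def)
    ultimately have "card {(a, b). a \<in> insert m S \<and> b \<in> insert m S \<and> b \<le> a}
        = card S * (card S + 1) div 2 + (card S + 1)"
      using insert.IH insert.hyps(1) by (subst \<open>_ = _ \<union> _\<close>, subst card_Un_disjoint) auto
    then show ?case
      using m insert.hyps(1) by simp
  qed simp
  show ?thesis
    unfolding conj_sign_def blade_sign_def fcard.rep_eq using *[of "fset A"] by simp
qed

lemma conj_sign_sdiff:
  "conj_sign (sdiff A B) * blade_sign A B = conj_sign A * conj_sign B * blade_sign B A"
proof -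
  have "conj_sign (sdiff A B) * blade_sign A B
      = conj_sign A * conj_sign B * blade_sign B A * (blade_sign A B * blade_sign A B)"
    by (simp only: conj_sign_eq blade_sign_sdiff_left blade_sign_sdiff_right mult_ac)
  then show ?thesis by (simp add: blade_sign_sq)
qed

lemma clifford_induct [case_names zero add]:
  assumes "P 0" "\<And>a A c. P a \<Longrightarrow> P (a + cscalar c * blade A)"
  shows "P a"
proof -
  have single: "Clifford (Poly_Mapping.single A c) = cscalar c * blade A" for A c
    by (metis coeffs_inverse coeffs_simps(2,4,5) cmult_single sdiff_empty(1) blade_sign_empty(1)
        mult.left_neutral mult.right_neutral)
  have add: "Clifford (f + g) = Clifford f + Clifford g" for f g
    by (metis Clifford_inverse UNIV_I coeffs_inverse coeffs_simps(1))
  have "P (Clifford f)" for f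
    by (induction f rule: poly_mapping_add_single_induct)
      (use assms in \<open>auto simp: add single zero_clifford_def\<close>)
  then show ?thesis by (metis coeffs_inverse)
qed

lemma main_inv_mult: "main_inv (a * b) = main_inv a * main_inv b"
proof (induction a rule: clifford_induct)
  case zero
  show ?case by simp
next
  case (add a A c)
  have "main_inv (cscalar c * blade A * b) = main_inv (cscalar c * blade A) * main_inv b"
  proof (induction b rule: clifford_induct)
    case zero
    show ?case by simp
  next
    case (add b B d)
    have s: "coeffs (main_inv (cscalar c * blade A))
        = Poly_Mapping.single A (main_sign A * c)" for c A
      by (rule poly_mapping_eqI)
        (simp add: lookup_main_inv coeffs_simps cmult_single lookup_single when_def)
    have "main_inv (cscalar c * blade A * (cscalar d * blade B))
        = main_inv (cscalar c * blade A) * main_inv (cscalar d * blade B)"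
      by (rule clifford_eqI) (auto simp: lookup_main_inv s coeffs_simps(2,4,5) cmult_single
          lookup_single when_def main_sign_sdiff)
    with add show ?case by (simp add: distrib_left main_inv_add)
  qed
  with add show ?case by (simp add: distrib_right main_inv_add)
qed

lemma clifford_conj_mult: "clifford_conj (a * b) = clifford_conj b * clifford_conj a"
proof (induction a rule: clifford_induct)
  case zero
  show ?case by simp
next
  case (add a A c)
  have "clifford_conj (cscalar c * blade A * b)
      = clifford_conj b * clifford_conj (cscalar c * blade A)"
  proof (induction b rule: clifford_induct)
    case zero
    show ?case by simp
  next
    case (add b B d)
    have s: "coeffs (clifford_conj (cscalar c * blade A))
        = Poly_Mapping.single A (conj_sign A * cnj c)" for c A
      by (rule poly_mapping_eqI)
        (simp add: lookup_clifford_conj coeffs_simps cmult_single lookup_single when_def)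
    have cnj_sign: "cnj (blade_sign A B) = blade_sign A B"
      by (simp add: blade_sign_def)
    have "clifford_conj (cscalar c * blade A * (cscalar d * blade B))
        = clifford_conj (cscalar d * blade B) * clifford_conj (cscalar c * blade A)"
      using conj_sign_sdiff[of A B]
      by (intro clifford_eqI) (auto simp: lookup_clifford_conj s coeffs_simps(2,4,5) cmult_single
          lookup_single when_def cnj_sign sdiff_commute[of A B] mult_ac)
    with add show ?case by (simp add: distrib_left distrib_right clifford_conj_add)
  qed
  with add show ?case by (simp add: distrib_left distrib_right clifford_conj_add)
qed

end

theory Submission
  imports Defs
begin

text \<open>
  With respect to the Fischer inner product, multiplication by \<open>|x|\<^sup>2\<close> is adjoint to the Laplacian
  and left multiplication by \<open>x\<close> is adjoint to \<open>- \<partial>\<close>, where \<open>\<partial>\<close> is the Dirac operator; this gives the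
  directness of both Fischer decompositions.  For a homogeneous \<open>f\<close> of degree \<open>n\<close> the harmonic part is
  \<open>\<Sum>\<^sub>j c\<^sub>j |x|\<^bsup>2j\<^esup> \<Delta>\<^sup>j f\<close> with explicit \<open>c\<^sub>j\<close>, and a harmonic \<open>h\<close> splits as
  \<open>h = (h + x \<partial>h / D) - x \<partial>h / D\<close> with \<open>D = 2 n + m - 2\<close>, the first summand being monogenic.  Since
  \<open>x \<partial> |x|\<^sup>2 = |x|\<^sup>2 (x \<partial> - 2)\<close>, it follows that \<open>P\<^sub>M f = P\<^sub>H (f + x \<partial>f / D)\<close>, which is the first pair of
  formulas.

  For the norms, \<open>\<parallel>P\<^sub>M f\<parallel>\<^sup>2 = \<parallel>P\<^sub>H f\<parallel>\<^sup>2 - \<parallel>P\<^sub>M (\<partial>f)\<parallel>\<^sup>2 / D\<close>, and \<open>\<partial>\<close> exchanges the two families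
  \<open>|u|\<^bsup>2s\<^esup> P Q\<close> and \<open>u |u|\<^bsup>2s\<^esup> P Q\<close> up to scalars, so both norms follow by induction on \<open>s\<close> from
  \<open>\<parallel>P\<^sub>H (|u|\<^bsup>2s\<^esup> A B)\<parallel>\<^sup>2 = c(s,k,i,p,q) \<parallel>A\<parallel>\<^sup>2 \<parallel>B\<parallel>\<^sup>2\<close> for harmonic \<open>A\<close>, \<open>B\<close>.  In the latter,
  \<open>|u|\<^sup>2 \<equiv> - |v|\<^sup>2\<close> modulo \<open>|x|\<^sup>2\<close> turns the left side into
  \<open>(-1)\<^sup>s \<langle>P\<^sub>H (|u|\<^bsup>2s\<^esup> A B), |v|\<^bsup>2s\<^esup> A B\<rangle>\<close>, to which only the term \<open>j = s\<close> of the sum contributes.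
\<close>

abbreviation "lookup \<equiv> Poly_Mapping.lookup"
abbreviation "keys \<equiv> Poly_Mapping.keys"
abbreviation "single \<equiv> Poly_Mapping.single"

section \<open>Scalars, variables and coefficients\<close>

lemma cscalar_add: "cscalar (c + d) = cscalar c + cscalar d"
  by transfer (simp add: single_add)

lemma cscalar_mult: "cscalar (c * d) = cscalar c * cscalar d"
  by transfer (simp add: cmult_single)

lemma cscalar_0 [simp]: "cscalar 0 = 0"
  by transfer simp

lemma cscalar_1 [simp]: "cscalar 1 = 1"
  by transfer simp

lemma cscalar_uminus: "cscalar (- c) = - cscalar c"
  using cscalar_add[of c "- c"] by (simp add: eq_neg_iff_add_eq_0 add.commute)

lemma of_nat_clifford: "of_nat n = cscalar (of_nat n)"
  by (induction n) (simp_all add: cscalar_add)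

lemma lookup_coeffs_cscalar_mult: "lookup (coeffs (cscalar c * a)) A = c * lookup (coeffs a) A"
proof -
  have "lookup (cmult (single {||} c) f) A = c * lookup f A" for f :: "nat fset \<Rightarrow>\<^sub>0 complex"
    by (induction f rule: poly_mapping_add_single_induct)
      (auto simp: cmult_add_right cmult_single lookup_add lookup_single when_def algebra_simps)
  then show ?thesis
    by (simp add: coeffs_simps)
qed

lemma cscalar_commute: "cscalar c * a = a * cscalar c"
proof -
  have "cmult (single {||} c) f = cmult f (single {||} c)" for f
    by (induction f rule: poly_mapping_add_single_induct)
      (auto simp: cmult_add_right cmult_add_left cmult_single mult.commute)
  then show ?thesis
    by transfer
qed

lemma mult_cscalar_left: "a * (cscalar c * b) = cscalar c * (a * b)"
  by (metis cscalar_commute mult.assoc)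

lemma single_sum: "single k (sum f S) = (\<Sum>x\<in>S. single k (f x))"
  by (induction S rule: infinite_finite_induct) (simp_all add: single_add)

lemma cconst_add: "cconst (a + b) = cconst a + cconst b"
  by (simp add: cconst_def single_add)

lemma cconst_mult: "cconst (a * b) = cconst a * cconst b"
  by (simp add: cconst_def mult_single)

lemma cconst_uminus: "cconst (- a) = - cconst a"
  by (simp add: cconst_def single_uminus)

lemma cconst_0 [simp]: "cconst 0 = 0"
  by (simp add: cconst_def)

lemma cconst_1 [simp]: "cconst 1 = 1"
  by (simp add: cconst_def)

lemma cconst_cscalar_commute: "cconst (cscalar c) * P = P * cconst (cscalar c)"
  by (induction P rule: poly_mapping_add_single_induct)
    (auto simp: cconst_def distrib_left distrib_right mult_single cscalar_commute)

interpretation cpoly: vector_space cscale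
  by unfold_locales
    (simp_all add: cscale_def distrib_left distrib_right cscalar_add cconst_add cscalar_mult
      cconst_mult mult.assoc)

lemma cscale_mult_left: "cscale c P * Q = cscale c (P * Q)"
  by (simp add: cscale_def mult.assoc)

lemma cscale_mult_right: "P * cscale c Q = cscale c (P * Q)"
  by (metis cconst_cscalar_commute cscale_def mult.assoc)

lemma of_nat_cscale: "of_nat n * P = cscale (of_nat n) P" for P :: cpoly
  by (simp add: cscale_def cconst_def of_nat_clifford[symmetric])

definition var :: "nat \<Rightarrow> cpoly" where
  "var j = single (single j 1) 1"

text \<open>The coefficient of \<open>var j\<close> is 1, so it is central even though Clifford
  coefficients do not commute. The centrality of \<open>norm_sq J\<close> follows from this.\<close>

lemma var_commute: "var j * P = P * var j"
  by (induction P rule: poly_mapping_add_single_induct)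
    (auto simp: var_def distrib_left distrib_right mult_single add.commute)

lemma vec_eq: "vec J = (\<Sum>j\<in>J. var j * cconst (gen j))"
  by (simp add: vec_def var_def cconst_def mult_single)

lemma norm_sq_eq: "norm_sq J = (\<Sum>j\<in>J. var j * var j)"
  by (simp add: norm_sq_def var_def mult_single single_add[symmetric] numeral_2_eq_2)

lemma norm_sq_commute: "norm_sq J * P = P * norm_sq J"
  unfolding norm_sq_eq sum_distrib_left sum_distrib_right
  by (intro sum.cong refl) (metis mult.assoc var_commute)

lemma norm_sq_power_commute: "norm_sq J ^ n * P = P * norm_sq J ^ n"
  by (metis norm_sq_commute power_commuting_commutes)

lemma gen_mult_gen: "cconst (gen i) * cconst (gen j)
    = cconst (cscalar (if i = j then - 2 else 0)) - cconst (gen j) * cconst (gen i)"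
  by (simp add: eq_diff_eq cconst_add[symmetric] cconst_mult[symmetric] gen_anticommute)

lemma cconst_gen_sq: "cconst (gen j) * cconst (gen j) = - 1"
proof -
  have "sdiff {|j|} {|j|} = {||}" "blade_sign {|j|} {|j|} = - 1"
    by (simp_all add: sdiff_def blade_sign_prod)
  then have "gen j * gen j = - 1"
    unfolding gen_def by transfer (simp add: cmult_single single_uminus)
  then show ?thesis
    by (simp add: cconst_mult[symmetric] cconst_uminus)
qed

section \<open>Partial derivatives\<close>

lemma lookup_partial: "lookup (partial j P) \<alpha> = of_nat (lookup \<alpha> j + 1) * lookup P (\<alpha> + single j 1)"
proof -
  have "lookup (partial j P) \<alpha>
      = (\<Sum>\<beta>\<in>keys P. if \<beta> = \<alpha> + single j 1 then of_nat (lookup \<beta> j) * lookup P \<beta> else 0)"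
    unfolding partial_def lookup_sum
  proof (intro sum.cong refl)
    fix \<beta>
    show "lookup (single (\<beta> - single j 1) (of_nat (lookup \<beta> j) * lookup P \<beta>)) \<alpha>
        = (if \<beta> = \<alpha> + single j 1 then of_nat (lookup \<beta> j) * lookup P \<beta> else 0)"
    proof (cases "lookup \<beta> j = 0")
      case False
      then have "\<beta> - single j 1 + single j 1 = \<beta>"
        by (intro poly_mapping_eqI) (auto simp: lookup_add lookup_minus lookup_single when_def)
      then have "\<beta> - single j 1 = \<alpha> \<longleftrightarrow> \<beta> = \<alpha> + single j 1"
        by (metis add_diff_cancel_right')
      then show ?thesis
        by (simp add: lookup_single when_def)
    next
      \<comment> \<open>Truncated subtraction leaves \<beta> unchanged when its exponent of
        \<open>j\<close> is 0, so its index can collide with \<alpha>; the factor 0 removes such a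
        term.\<close>
      case True
      then have "of_nat (lookup \<beta> j) * lookup P \<beta> = 0"
        by simp
      then show ?thesis
        by (simp only: single_zero lookup_zero if_cancel)
    qed
  qed
  also have "\<dots> = of_nat (lookup \<alpha> j + 1) * lookup P (\<alpha> + single j 1)"
    by (simp add: sum.delta lookup_add in_keys_iff)
  finally show ?thesis .
qed

lemma partial_0 [simp]: "partial j 0 = 0"
  by (simp add: partial_def)

lemma partial_add: "partial j (P + Q) = partial j P + partial j Q"
  by (rule poly_mapping_eqI) (simp add: lookup_partial lookup_add distrib_left)

lemma partial_sum: "partial j (sum f S) = (\<Sum>x\<in>S. partial j (f x))"
  by (induction S rule: infinite_finite_induct) (simp_all add: partial_add)

lemma partial_single: "partial j (single \<alpha> a) = single (\<alpha> - single j 1) (of_nat (lookup \<alpha> j) * a)"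
  by (cases "a = 0") (simp_all add: partial_def)

lemma partial_mult: "partial j (P * Q) = partial j P * Q + P * partial j Q"
proof (induction P rule: poly_mapping_add_single_induct)
  case (single P \<alpha> a)
  have "partial j (single \<alpha> a * Q) = partial j (single \<alpha> a) * Q + single \<alpha> a * partial j Q"
  proof (induction Q rule: poly_mapping_add_single_induct)
    case (single Q \<beta> b)
    \<comment> \<open>Truncated subtraction passes to one summand only if the exponent of
      \<open>j\<close> there is positive; otherwise the derivative of that factor is 0.\<close>
    have 1: "\<alpha> + \<beta> - single j 1 = \<alpha> - single j 1 + \<beta>" if "lookup \<alpha> j \<noteq> 0"
      using that by (auto intro!: poly_mapping_eqI simp: lookup_add lookup_minus lookup_single when_def)
    have 2: "\<alpha> + \<beta> - single j 1 = \<alpha> + (\<beta> - single j 1)" if "lookup \<beta> j \<noteq> 0"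
      using that by (auto intro!: poly_mapping_eqI simp: lookup_add lookup_minus lookup_single when_def)
    have "partial j (single \<alpha> a * single \<beta> b)
        = partial j (single \<alpha> a) * single \<beta> b + single \<alpha> a * partial j (single \<beta> b)"
      using 1 2 mult_of_nat_commute[of "lookup \<beta> j" a, symmetric]
      by (cases "lookup \<alpha> j = 0"; cases "lookup \<beta> j = 0")
        (simp_all add: mult_single partial_single lookup_add distrib_right mult.assoc[symmetric]
          single_add[symmetric])
    with single show ?case
      by (simp add: distrib_left partial_add algebra_simps)
  qed simp
  with single show ?case
    by (simp add: distrib_right partial_add)
qed simp

lemma partial_commute: "partial i (partial j P) = partial j (partial i P)"
proof (cases "i = j")
  case False
  show ?thesis
  proof (rule poly_mapping_eqI)
    fix \<alpha> :: "nat \<Rightarrow>\<^sub>0 nat"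
    have 1: "\<alpha> + single i 1 + single j 1 = \<alpha> + single j 1 + single i 1"
      by (simp only: ac_simps)
    have 2: "of_nat m * (of_nat n * a) = of_nat n * (of_nat m * a)" for m n and a :: clifford
      by (simp only: mult.assoc[symmetric] of_nat_mult[symmetric] mult.commute)
    have "lookup (single i (1::nat)) j = 0" "lookup (single j (1::nat)) i = 0"
      using False by (simp_all add: lookup_single_not_eq)
    then show "lookup (partial i (partial j P)) \<alpha> = lookup (partial j (partial i P)) \<alpha>"
      by (simp only: lookup_partial lookup_add 1 add_0_right 2)
  qed
qed simp

lemma partial_cconst [simp]: "partial j (cconst a) = 0"
  by (simp add: cconst_def partial_single)

lemma partial_cconst_mult: "partial j (cconst a * P) = cconst a * partial j P"
  by (simp add: partial_mult)

lemma partial_cscale: "partial j (cscale c P) = cscale c (partial j P)"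
  by (simp add: cscale_def partial_cconst_mult)

lemma partial_var: "partial j (var i) = (if i = j then 1 else 0)"
  by (auto simp: var_def partial_single lookup_single_not_eq)

section \<open>The Fischer inner product\<close>

text \<open>The Hermitian form for which the blades are orthonormal, conjugate linear on the left;
  the Fischer product is a weighted sum of such forms over the monomials.\<close>

definition cinner :: "clifford \<Rightarrow> clifford \<Rightarrow> complex" where
  "cinner a b = scalar_part (clifford_conj a * b)"

lemma scalar_part_add: "scalar_part (a + b) = scalar_part a + scalar_part b"
  by transfer (simp add: lookup_add)

lemma scalar_part_0 [simp]: "scalar_part 0 = 0"
  by transfer simp

lemma scalar_part_conj: "scalar_part (clifford_conj a) = cnj (scalar_part a)"
  using lookup_clifford_conj[of a "{||}"]
  by (simp add: scalar_part.rep_eq conj_sign_def fcard.rep_eq)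

lemma clifford_conj_conj [simp]: "clifford_conj (clifford_conj a) = a"
  by (rule clifford_eqI) (simp add: lookup_clifford_conj conj_sign_def power_mult_distrib[symmetric]
      mult.assoc[symmetric])

lemma cinner_add_left: "cinner (a + b) c = cinner a c + cinner b c"
  by (simp add: cinner_def clifford_conj_add distrib_right scalar_part_add)

lemma cinner_add_right: "cinner a (b + c) = cinner a b + cinner a c"
  by (simp add: cinner_def distrib_left scalar_part_add)

lemma cinner_0 [simp]: "cinner 0 a = 0" "cinner a 0 = 0"
  by (simp_all add: cinner_def)

lemma cinner_commute: "cinner b a = cnj (cinner a b)"
  by (simp add: cinner_def scalar_part_conj[symmetric] clifford_conj_mult)

lemma cinner_mult_left: "cinner (x * a) b = cinner a (clifford_conj x * b)"
  by (simp add: cinner_def clifford_conj_mult mult.assoc)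

lemma scalar_part_cscalar_mult: "scalar_part (cscalar c * a) = c * scalar_part a"
  by (simp add: scalar_part.rep_eq lookup_coeffs_cscalar_mult)

lemma cinner_scalar_left: "cinner (cscalar c * a) b = cnj c * cinner a b"
  by (simp add: cinner_mult_left clifford_conj_scalar)
    (simp add: cinner_def mult_cscalar_left scalar_part_cscalar_mult)

lemma cinner_scalar_right: "cinner a (cscalar c * b) = c * cinner a b"
  by (metis cinner_commute cinner_scalar_left complex_cnj_mult complex_cnj_cnj)

lemma sdiff_eq_empty_iff: "sdiff A B = {||} \<longleftrightarrow> A = B"
  by (auto simp: sdiff_def)

text \<open>The conjugate of one blade times another is a multiple of the blade on the symmetric
  difference, so it has a scalar part only for equal blades; there the signs
  \<open>conj_sign A\<close> and \<open>blade_sign A A\<close> agree and cancel.\<close>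

lemma cinner_blade: "cinner (blade A) b = lookup (coeffs b) A"
proof (induction b rule: clifford_induct)
  case (add b B c)
  have "coeffs (clifford_conj (blade A)) = single A (conj_sign A)"
    by (rule poly_mapping_eqI)
      (simp add: lookup_clifford_conj coeffs_simps lookup_single when_def)
  then have "cinner (blade A) (blade B) = (if A = B then 1 else 0)"
    by (auto simp: cinner_def scalar_part.rep_eq coeffs_simps cmult_single lookup_single when_def
        sdiff_eq_empty_iff conj_sign_eq blade_sign_sq)
  with add show ?case
    by (simp add: cinner_add_right cinner_scalar_right coeffs_simps(1) lookup_add
        lookup_coeffs_cscalar_mult) (auto simp: coeffs_simps lookup_single)
qed (simp add: coeffs_simps)

lemma coeffs_sum: "coeffs (sum f S) = (\<Sum>x\<in>S. coeffs (f x))"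
  by (induction S rule: infinite_finite_induct) (simp_all add: coeffs_simps)

lemma clifford_eq_sum: "a = (\<Sum>A\<in>keys (coeffs a). cscalar (lookup (coeffs a) A) * blade A)"
  by (rule clifford_eqI)
    (auto simp: coeffs_sum coeffs_simps cmult_single lookup_sum_single in_keys_iff)

lemma cinner_sum_left: "cinner (sum f S) b = (\<Sum>x\<in>S. cinner (f x) b)"
  by (induction S rule: infinite_finite_induct) (simp_all add: cinner_add_left)

lemma cinner_self: "cinner a a = of_real (\<Sum>A\<in>keys (coeffs a). (cmod (lookup (coeffs a) A))\<^sup>2)"
proof -
  have "cinner a a = (\<Sum>A\<in>keys (coeffs a). cinner (cscalar (lookup (coeffs a) A) * blade A) a)"
    by (subst cinner_sum_left[symmetric], subst clifford_eq_sum[symmetric]) simp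
  then show ?thesis
    by (simp add: cinner_scalar_left cinner_blade complex_norm_square[symmetric] mult.commute)
qed

lemma cinner_self_eq_0_iff: "Re (cinner a a) = 0 \<longleftrightarrow> a = 0"
proof
  assume "Re (cinner a a) = 0"
  then have "\<forall>A\<in>keys (coeffs a). (cmod (lookup (coeffs a) A))\<^sup>2 = 0"
    by (subst (asm) cinner_self) (simp add: sum_nonneg_eq_0_iff)
  then show "a = 0"
    by (intro clifford_eqI) (auto simp: coeffs_simps in_keys_iff)
qed simp

lemma cinner_self_nonneg: "Re (cinner a a) \<ge> 0"
  by (simp add: cinner_self sum_nonneg)

section \<open>Multi-index factorials and the Fischer product in coefficients\<close>

definition mfact :: "(nat \<Rightarrow>\<^sub>0 nat) \<Rightarrow> nat" where
  "mfact \<alpha> = (\<Prod>j\<in>keys \<alpha>. fact (lookup \<alpha> j))"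

lemma mfact_superset:
  assumes "finite S" "keys \<alpha> \<subseteq> S"
  shows "mfact \<alpha> = (\<Prod>j\<in>S. fact (lookup \<alpha> j))"
  unfolding mfact_def using assms by (intro prod.mono_neutral_left) (auto simp: in_keys_iff)

lemma mfact_pos: "mfact \<alpha> > 0"
  by (simp add: mfact_def prod_pos)

lemma mfact_add_single: "mfact (\<alpha> + single j 1) = Suc (lookup \<alpha> j) * mfact \<alpha>"
proof -
  define S where "S = keys \<alpha> - {j}"
  have *: "finite (insert j S)" "finite S" "j \<notin> S"
    by (auto simp: S_def)
  have "keys \<alpha> \<subseteq> insert j S" "keys (\<alpha> + single j 1) \<subseteq> insert j S"
    by (auto simp: S_def in_keys_iff lookup_add lookup_single when_def split: if_splits)
  moreover have "(\<Prod>i\<in>S. fact (lookup (\<alpha> + single j 1) i)) = (\<Prod>i\<in>S. fact (lookup \<alpha> i) :: nat)"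
    using *(3) by (intro prod.cong) (auto simp: lookup_add lookup_single when_def)
  ultimately show ?thesis
    using * by (simp add: mfact_superset[of "insert j S"] lookup_add algebra_simps)
qed

lemma mfact_add:
  assumes "keys \<alpha> \<inter> keys \<beta> = {}"
  shows "mfact (\<alpha> + \<beta>) = mfact \<alpha> * mfact \<beta>"
proof -
  have "mfact (\<alpha> + \<beta>) = (\<Prod>j\<in>keys \<alpha> \<union> keys \<beta>. fact (lookup (\<alpha> + \<beta>) j))"
    by (rule mfact_superset) (use Poly_Mapping.keys_add[of \<alpha> \<beta>] in auto)
  also have "\<dots> = (\<Prod>j\<in>keys \<alpha>. fact (lookup (\<alpha> + \<beta>) j)) * (\<Prod>j\<in>keys \<beta>. fact (lookup (\<alpha> + \<beta>) j))"
    using assms by (intro prod.union_disjoint) auto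
  also have "(\<Prod>j\<in>keys \<alpha>. fact (lookup (\<alpha> + \<beta>) j) :: nat) = mfact \<alpha>"
    unfolding mfact_def
    using assms by (intro prod.cong refl) (metis IntI add.right_neutral empty_iff in_keys_iff lookup_add)
  also have "(\<Prod>j\<in>keys \<beta>. fact (lookup (\<alpha> + \<beta>) j) :: nat) = mfact \<beta>"
    unfolding mfact_def
    using assms by (intro prod.cong refl) (metis IntI add.left_neutral empty_iff in_keys_iff lookup_add)
  finally show ?thesis .
qed

lemma lookup_partial_power:
  "lookup ((partial j ^^ n) P) \<alpha> = of_nat (\<Prod>l<n. lookup \<alpha> j + 1 + l) * lookup P (\<alpha> + single j n)"
proof (induction n arbitrary: \<alpha>)
  case (Suc n)
  have "\<alpha> + single j 1 + single j n = \<alpha> + single j (Suc n)"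
    by (simp add: add.assoc single_add[symmetric])
  moreover have "(\<Prod>l<Suc n. lookup \<alpha> j + 1 + l) = (lookup \<alpha> j + 1) * (\<Prod>l<n. lookup \<alpha> j + 1 + 1 + l)"
    by (subst prod.lessThan_Suc_shift) simp
  ultimately show ?case
    by (simp only: funpow.simps o_apply lookup_partial Suc lookup_add lookup_single_eq of_nat_mult
        mult.assoc)
qed simp

lemma lookup_multi_partial: "lookup (multi_partial \<alpha> Q) 0 = of_nat (mfact \<alpha>) * lookup Q \<alpha>"
proof -
  \<comment> \<open>Each derivative shifts the monomial, so the claim is generalised from 0 to
    \<beta>. As \<beta> vanishes on the listed variables, which are distinct, every variable
    contributes a full factorial.\<close>
  have "lookup (foldr (\<lambda>j. partial j ^^ lookup \<alpha> j) js Q) \<beta>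
      = of_nat (\<Prod>j\<in>set js. fact (lookup \<alpha> j)) * lookup Q (\<beta> + (\<Sum>j\<in>set js. single j (lookup \<alpha> j)))"
    if "distinct js" "\<forall>j\<in>set js. lookup \<beta> j = 0" for js \<beta>
    using that
  proof (induction js arbitrary: \<beta>)
    case (Cons j js)
    have f: "(\<Prod>l<n. Suc l) = fact n" for n
      by (induction n) (simp_all add: mult.commute)
    have "\<forall>i\<in>set js. lookup (\<beta> + single j (lookup \<alpha> j)) i = 0"
      using Cons.prems by (auto simp: lookup_add lookup_single when_def)
    with Cons show ?case
      by (simp add: lookup_partial_power f add.assoc mult.assoc)
  qed simp
  moreover have "(\<Sum>j\<in>keys \<alpha>. single j (lookup \<alpha> j)) = \<alpha>"
    by (rule poly_mapping_eqI) (simp add: lookup_sum_single in_keys_iff)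
  ultimately show ?thesis
    by (simp add: multi_partial_def mfact_def)
qed

lemma lookup_cconst_mult: "lookup (cconst a * P) \<alpha> = a * lookup P \<alpha>"
  by (induction P rule: poly_mapping_add_single_induct)
    (auto simp: distrib_left lookup_add cconst_def mult_single lookup_single when_def)

lemma scalar_part_sum: "scalar_part (sum f S) = (\<Sum>x\<in>S. scalar_part (f x))"
  by (induction S rule: infinite_finite_induct) (simp_all add: scalar_part_add)

text \<open>The product is diagonal in the monomials, with weight \<alpha>!. A common superset of
  the supports allows polynomials with different supports to be added termwise.\<close>

lemma fischer_inner_superset:
  assumes "finite S" "keys P \<subseteq> S"
  shows "fischer_inner P Q = (\<Sum>\<alpha>\<in>S. of_nat (mfact \<alpha>) * cinner (lookup P \<alpha>) (lookup Q \<alpha>))"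
proof -
  have "fischer_inner P Q = (\<Sum>\<alpha>\<in>keys P. of_nat (mfact \<alpha>) * cinner (lookup P \<alpha>) (lookup Q \<alpha>))"
    unfolding fischer_inner_def lookup_sum scalar_part_sum lookup_cconst_mult lookup_multi_partial
    by (intro sum.cong refl)
      (simp add: cinner_def of_nat_clifford mult_cscalar_left scalar_part_cscalar_mult)
  also have "\<dots> = (\<Sum>\<alpha>\<in>S. of_nat (mfact \<alpha>) * cinner (lookup P \<alpha>) (lookup Q \<alpha>))"
    using assms by (intro sum.mono_neutral_left) (auto simp: in_keys_iff)
  finally show ?thesis .
qed

lemma fischer_inner_add_left: "fischer_inner (P + P') Q = fischer_inner P Q + fischer_inner P' Q"
proof -
  define S where "S = keys P \<union> keys P'"
  have S: "finite S" "keys P \<subseteq> S" "keys P' \<subseteq> S" "keys (P + P') \<subseteq> S"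
    using Poly_Mapping.keys_add[of P P'] by (auto simp: S_def)
  show ?thesis
    by (simp add: fischer_inner_superset[OF S(1,2)] fischer_inner_superset[OF S(1,3)]
        fischer_inner_superset[OF S(1,4)] lookup_add cinner_add_left distrib_left sum.distrib)
qed

lemma fischer_inner_commute: "fischer_inner Q P = cnj (fischer_inner P Q)"
proof -
  define S where "S = keys P \<union> keys Q"
  have S: "finite S" "keys P \<subseteq> S" "keys Q \<subseteq> S"
    by (auto simp: S_def)
  show ?thesis
    by (simp add: fischer_inner_superset[OF S(1,2)] fischer_inner_superset[OF S(1,3)]
        cinner_commute[symmetric])
qed

lemma fischer_inner_add_right: "fischer_inner Q (P + P') = fischer_inner Q P + fischer_inner Q P'"
  by (metis fischer_inner_commute fischer_inner_add_left complex_cnj_add)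

lemma fischer_inner_0 [simp]: "fischer_inner 0 Q = 0" "fischer_inner Q 0 = 0"
  by (simp_all add: fischer_inner_superset[OF finite_keys order_refl])

lemma fischer_inner_single_left:
  "fischer_inner (single \<alpha> a) Q = of_nat (mfact \<alpha>) * cinner a (lookup Q \<alpha>)"
  by (simp add: fischer_inner_superset[of "{\<alpha>}"])

lemma fischer_inner_cconst_mult: "fischer_inner (cconst a * P) Q = fischer_inner P (cconst (clifford_conj a) * Q)"
proof (induction P rule: poly_mapping_add_single_induct)
  case (single P \<alpha> b)
  have "fischer_inner (cconst a * single \<alpha> b) Q = fischer_inner (single \<alpha> b) (cconst (clifford_conj a) * Q)"
    unfolding cconst_def mult_single
    by (simp add: fischer_inner_single_left cinner_mult_left flip: cconst_def)
      (simp add: lookup_cconst_mult)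
  with single show ?case
    by (simp add: distrib_left fischer_inner_add_left)
qed simp

lemma fischer_inner_cscale_left: "fischer_inner (cscale c P) Q = cnj c * fischer_inner P Q"
proof (induction P rule: poly_mapping_add_single_induct)
  case (single P \<alpha> b)
  have "fischer_inner (cscale c (single \<alpha> b)) Q = cnj c * fischer_inner (single \<alpha> b) Q"
    by (simp add: cscale_def cconst_def mult_single fischer_inner_single_left cinner_scalar_left)
  with single show ?case
    by (simp add: fischer_inner_add_left distrib_left cpoly.scale_right_distrib)
qed simp

lemma fischer_inner_cscale_right: "fischer_inner Q (cscale c P) = c * fischer_inner Q P"
  by (metis fischer_inner_commute fischer_inner_cscale_left complex_cnj_mult complex_cnj_cnj)

lemma fischer_inner_minus_right: "fischer_inner Q (- P) = - fischer_inner Q P"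
  using fischer_inner_cscale_right[of _ "- 1"] by simp

lemma fischer_inner_sum_left: "fischer_inner (sum f S) Q = (\<Sum>x\<in>S. fischer_inner (f x) Q)"
  by (induction S rule: infinite_finite_induct) (simp_all add: fischer_inner_add_left)

lemma fischer_inner_sum_right: "fischer_inner Q (sum f S) = (\<Sum>x\<in>S. fischer_inner Q (f x))"
  by (induction S rule: infinite_finite_induct) (simp_all add: fischer_inner_add_right)

text \<open>All terms of the weighted sum are nonnegative, so they vanish one by one. This
  definiteness is what makes both Fischer decompositions direct.\<close>

lemma fischer_inner_self_eq_0_iff: "fischer_inner P P = 0 \<longleftrightarrow> P = 0"
proof
  assume "fischer_inner P P = 0"
  then have "(\<Sum>\<alpha>\<in>keys P. real (mfact \<alpha>) * Re (cinner (lookup P \<alpha>) (lookup P \<alpha>))) = 0"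
    by (simp add: fischer_inner_superset[of "keys P"] complex_eq_iff)
  then have "\<forall>\<alpha>\<in>keys P. real (mfact \<alpha>) * Re (cinner (lookup P \<alpha>) (lookup P \<alpha>)) = 0"
    by (subst (asm) sum_nonneg_eq_0_iff) (auto simp: cinner_self_nonneg)
  then have "lookup P \<alpha> = 0" for \<alpha>
    using mfact_pos[of \<alpha>] by (cases "\<alpha> \<in> keys P") (auto simp: cinner_self_eq_0_iff in_keys_iff)
  then show "P = 0"
    by (intro poly_mapping_eqI) simp
qed simp

text \<open>Raising the exponent of x_j multiplies \<alpha>! by \<alpha>_j + 1, which is the factor
  that differentiation produces.\<close>

lemma fischer_inner_var_mult: "fischer_inner (var j * P) Q = fischer_inner P (partial j Q)"
proof (induction P rule: poly_mapping_add_single_induct)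
  case (single P \<alpha> b)
  have "fischer_inner (var j * single \<alpha> b) Q = fischer_inner (single \<alpha> b) (partial j Q)"
    unfolding var_def mult_single
    by (simp add: fischer_inner_single_left lookup_partial add.commute[of "single j _"]
        of_nat_clifford cinner_scalar_right mfact_add_single[simplified] algebra_simps)
  with single show ?case
    by (simp add: distrib_left fischer_inner_add_left)
qed simp

section \<open>Homogeneous polynomials\<close>

lemma clifford_on_iff: "a \<in> clifford_on J \<longleftrightarrow> (\<forall>A. lookup (coeffs a) A \<noteq> 0 \<longrightarrow> fset A \<subseteq> J)"
  by (auto simp: clifford_on_def in_keys_iff)

lemma cpoly_on_iff:
  "P \<in> cpoly_on J \<longleftrightarrow> (\<forall>\<alpha>. lookup P \<alpha> \<noteq> 0 \<longrightarrow> keys \<alpha> \<subseteq> J \<and> lookup P \<alpha> \<in> clifford_on J)"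
  by (auto simp: cpoly_on_def in_keys_iff)

lemma blade_mult: "blade A * blade B = cscalar (blade_sign A B) * blade (sdiff A B)"
  by (rule clifford_eqI) (simp add: coeffs_simps cmult_single)

lemma blade_empty [simp]: "blade {||} = 1"
  by transfer simp

lemma cpoly_on_0 [simp]: "0 \<in> cpoly_on J"
  by (simp add: cpoly_on_iff)

lemma cpoly_on_add: "P \<in> cpoly_on J \<Longrightarrow> Q \<in> cpoly_on J \<Longrightarrow> P + Q \<in> cpoly_on J"
  unfolding cpoly_on_iff clifford_on_iff lookup_add coeffs_simps
  by (metis add.right_neutral add.left_neutral coeffs_simps(3) lookup_zero)

lemma cpoly_on_single: "keys \<alpha> \<subseteq> J \<Longrightarrow> fset A \<subseteq> J \<Longrightarrow> single \<alpha> (cscalar c * blade A) \<in> cpoly_on J"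
  by (auto simp: cpoly_on_iff clifford_on_iff coeffs_simps cmult_single lookup_single when_def
      split: if_splits)

text \<open>Linear statements reduce to terms consisting of a scalar, a monomial and a blade, the
  last two supported in \<open>J\<close>.\<close>

lemma cpoly_on_induct [consumes 1, case_names zero add]:
  assumes "P \<in> cpoly_on J" and "R 0"
    and step: "\<And>P \<alpha> A c. P \<in> cpoly_on J \<Longrightarrow> R P \<Longrightarrow> keys \<alpha> \<subseteq> J \<Longrightarrow> fset A \<subseteq> J
      \<Longrightarrow> R (P + single \<alpha> (cscalar c * blade A))"
  shows "R P"
proof -
  define S where "S = Sigma (keys P) (\<lambda>\<alpha>. keys (coeffs (lookup P \<alpha>)))"
  define f where "f = (\<lambda>(\<alpha>, A). single \<alpha> (cscalar (lookup (coeffs (lookup P \<alpha>)) A) * blade A))"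
  have S: "keys \<alpha> \<subseteq> J \<and> fset A \<subseteq> J" if "(\<alpha>, A) \<in> S" for \<alpha> A
    using that assms(1) by (auto simp: S_def cpoly_on_def clifford_on_def)
  have "P = (\<Sum>\<alpha>\<in>keys P. single \<alpha> (lookup P \<alpha>))"
    by (rule poly_mapping_eqI) (simp add: lookup_sum_single in_keys_iff)
  also have "\<dots> = (\<Sum>\<alpha>\<in>keys P. \<Sum>A\<in>keys (coeffs (lookup P \<alpha>)). f (\<alpha>, A))"
    by (simp add: f_def flip: single_sum clifford_eq_sum)
  also have "\<dots> = sum f S"
    by (simp add: S_def sum.Sigma)
  finally have P: "P = sum f S" .
  have "finite S"
    by (simp add: S_def)
  \<comment> \<open>Running over subsets of \<open>S\<close> keeps every partial sum in
    \<open>cpoly_on J\<close>, as the step hypothesis requires.\<close>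
  moreover have "sum f T \<in> cpoly_on J \<and> R (sum f T)" if "finite T" "T \<subseteq> S" for T
    using that
  proof induction
    case (insert x T)
    obtain \<alpha> A where x: "x = (\<alpha>, A)" by fastforce
    with insert.prems S have *: "keys \<alpha> \<subseteq> J" "fset A \<subseteq> J" by auto
    then have "f x \<in> cpoly_on J"
      by (simp add: x f_def cpoly_on_single)
    moreover have "R (sum f T + f x)"
      using insert * by (auto simp: x f_def intro!: step)
    ultimately show ?case
      using insert by (auto simp: add.commute intro: cpoly_on_add)
  qed (use assms in auto)
  ultimately show ?thesis
    using P by auto
qed

lemma single_blade_mult:
  "single \<alpha> (cscalar c * blade A) * single \<beta> (cscalar d * blade B)
    = single (\<alpha> + \<beta>) (cscalar (c * d * blade_sign A B) * blade (sdiff A B))"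
proof -
  have "cscalar c * blade A * (cscalar d * blade B) = cscalar c * cscalar d * (blade A * blade B)"
    by (metis mult.assoc mult_cscalar_left)
  then show ?thesis
    by (simp add: mult_single blade_mult cscalar_mult mult.assoc)
qed

lemma cpoly_on_mult:
  assumes "P \<in> cpoly_on J" "Q \<in> cpoly_on J"
  shows "P * Q \<in> cpoly_on J"
  using assms(1)
proof (induction rule: cpoly_on_induct)
  case (add P \<alpha> A c)
  have "single \<alpha> (cscalar c * blade A) * Q \<in> cpoly_on J"
    using assms(2)
  proof (induction rule: cpoly_on_induct)
    case (add Q \<beta> B d)
    have "keys (\<alpha> + \<beta>) \<subseteq> J" "fset (sdiff A B) \<subseteq> J"
      using add \<open>keys \<alpha> \<subseteq> J\<close> \<open>fset A \<subseteq> J\<close> Poly_Mapping.keys_add[of \<alpha> \<beta>] by (auto simp: fset_sdiff)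
    then have "single \<alpha> (cscalar c * blade A) * single \<beta> (cscalar d * blade B) \<in> cpoly_on J"
      unfolding single_blade_mult by (rule cpoly_on_single)
    with add show ?case
      by (simp add: distrib_left cpoly_on_add)
  qed simp
  with add show ?case
    by (simp add: distrib_right cpoly_on_add)
qed simp

lemma cpoly_on_cscalar [simp]: "cconst (cscalar c) \<in> cpoly_on J"
  using cpoly_on_single[of 0 J "{||}" c] by (simp add: cconst_def)

lemma cpoly_on_cscale: "P \<in> cpoly_on J \<Longrightarrow> cscale c P \<in> cpoly_on J"
  by (simp add: cscale_def cpoly_on_mult)

lemma cpoly_on_gen: "j \<in> J \<Longrightarrow> cconst (gen j) \<in> cpoly_on J"
  using cpoly_on_single[of 0 J "{|j|}" 1] by (simp add: cconst_def gen_def)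

lemma cpoly_on_var: "j \<in> J \<Longrightarrow> var j \<in> cpoly_on J"
  using cpoly_on_single[of "single j 1" J "{||}" 1] by (simp add: var_def)

lemma cpoly_on_mono: "P \<in> cpoly_on J \<Longrightarrow> J \<subseteq> K \<Longrightarrow> P \<in> cpoly_on K"
  unfolding cpoly_on_iff clifford_on_iff by (meson order_trans)

lemma cpoly_on_partial: "P \<in> cpoly_on J \<Longrightarrow> partial j P \<in> cpoly_on J"
proof (induction rule: cpoly_on_induct)
  case (add P \<alpha> A c)
  have "keys (\<alpha> - single j 1) \<subseteq> J"
    using add by (auto simp: in_keys_iff lookup_minus)
  then have "single (\<alpha> - single j 1) (cscalar (of_nat (lookup \<alpha> j) * c) * blade A) \<in> cpoly_on J"
    using add by (intro cpoly_on_single)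
  with add show ?case
    by (simp add: partial_add partial_single of_nat_clifford cscalar_mult mult.assoc cpoly_on_add)
qed simp

lemma partial_eq_0: "P \<in> cpoly_on J \<Longrightarrow> j \<notin> J \<Longrightarrow> partial j P = 0"
proof (induction rule: cpoly_on_induct)
  case (add P \<alpha> A c)
  then have "lookup \<alpha> j = 0"
    by (auto simp: in_keys_iff)
  with add show ?case
    by (simp add: partial_add partial_single)
qed simp

section \<open>Degrees and Euler's formula\<close>

definition mdeg :: "(nat \<Rightarrow>\<^sub>0 nat) \<Rightarrow> nat" where
  "mdeg \<alpha> = (\<Sum>j\<in>keys \<alpha>. lookup \<alpha> j)"

lemma mdeg_superset:
  assumes "finite S" "keys \<alpha> \<subseteq> S"
  shows "mdeg \<alpha> = (\<Sum>j\<in>S. lookup \<alpha> j)"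
  unfolding mdeg_def using assms by (intro sum.mono_neutral_left) (auto simp: in_keys_iff)

lemma mdeg_add: "mdeg (\<alpha> + \<beta>) = mdeg \<alpha> + mdeg \<beta>"
  using Poly_Mapping.keys_add[of \<alpha> \<beta>]
  by (simp add: mdeg_superset[of "keys \<alpha> \<union> keys \<beta>"] lookup_add sum.distrib)

lemma homogeneous_iff: "homogeneous k P \<longleftrightarrow> (\<forall>\<alpha>. lookup P \<alpha> \<noteq> 0 \<longrightarrow> mdeg \<alpha> = k)"
  by (auto simp: homogeneous_def in_keys_iff mdeg_def)

text \<open>Degree and index set are kept together because the operators respect both. Zero lies in
  every degree, so the truncated degrees k - 1 and k - 2 below are correct for small k as
  well.\<close>

definition forms :: "nat \<Rightarrow> nat set \<Rightarrow> cpoly set" where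
  "forms k J = {P \<in> cpoly_on J. homogeneous k P}"

lemma forms_0 [simp]: "0 \<in> forms k J"
  by (simp add: forms_def homogeneous_iff)

lemma forms_add: "P \<in> forms k J \<Longrightarrow> Q \<in> forms k J \<Longrightarrow> P + Q \<in> forms k J"
  by (simp add: forms_def homogeneous_iff lookup_add cpoly_on_add) (metis add.right_neutral)

lemma forms_sum: "(\<And>x. x \<in> S \<Longrightarrow> f x \<in> forms k J) \<Longrightarrow> sum f S \<in> forms k J"
  by (induction S rule: infinite_finite_induct) (auto intro: forms_add)

lemma forms_mult: "P \<in> forms k J \<Longrightarrow> Q \<in> forms l J \<Longrightarrow> P * Q \<in> forms (k + l) J"
  using Poly_Mapping.keys_mult[of P Q]
  by (fastforce simp: forms_def cpoly_on_mult homogeneous_iff mdeg_add simp flip: in_keys_iff)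

lemma forms_cconst: "cconst a \<in> cpoly_on J \<Longrightarrow> cconst a \<in> forms 0 J"
  by (auto simp: forms_def homogeneous_iff cconst_def lookup_single when_def mdeg_def)

lemma forms_cscale: "P \<in> forms k J \<Longrightarrow> cscale c P \<in> forms k J"
  using forms_mult[of "cconst (cscalar c)" 0 J P k] by (simp add: cscale_def forms_cconst)

lemma forms_uminus: "P \<in> forms k J \<Longrightarrow> - P \<in> forms k J"
  using forms_cscale[of P k J "- 1"] by simp

lemma forms_diff: "P \<in> forms k J \<Longrightarrow> Q \<in> forms k J \<Longrightarrow> P - Q \<in> forms k J"
  using forms_add[of P k J "- Q"] by (simp add: forms_uminus)

lemma forms_var: "j \<in> J \<Longrightarrow> var j \<in> forms 1 J"
  using cpoly_on_var[of j J]
  by (auto simp: forms_def homogeneous_iff var_def lookup_single when_def mdeg_def)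

lemma forms_mono: "P \<in> forms k J \<Longrightarrow> J \<subseteq> K \<Longrightarrow> P \<in> forms k K"
  by (auto simp: forms_def cpoly_on_mono)

lemma mdeg_add_single: "mdeg (\<alpha> + single j 1) = Suc (mdeg \<alpha>)"
  unfolding mdeg_add by (simp add: mdeg_def)

lemma mdeg_if_lookup_partial:
  assumes "P \<in> forms k J" "lookup (partial j P) \<alpha> \<noteq> 0"
  shows "k = Suc (mdeg \<alpha>)"
proof -
  have "lookup P (\<alpha> + single j 1) \<noteq> 0"
    using assms(2) unfolding lookup_partial by auto
  then have "mdeg (\<alpha> + single j 1) = k"
    using assms(1) by (simp add: forms_def homogeneous_iff)
  then show ?thesis
    by (simp only: mdeg_add_single)
qed

lemma forms_partial: "P \<in> forms k J \<Longrightarrow> partial j P \<in> forms (k - 1) J"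
  using mdeg_if_lookup_partial[of P k J j]
  by (fastforce simp: forms_def homogeneous_iff cpoly_on_partial)

lemma forms_zero_partial: "P \<in> forms 0 J \<Longrightarrow> partial j P = 0"
  using mdeg_if_lookup_partial[of P 0 J j] by (intro poly_mapping_eqI) force

lemma forms_vec: "vec J \<in> forms 1 J"
  unfolding vec_eq
  by (intro forms_sum) (metis forms_mult[of _ 1 _ _ 0] forms_var forms_cconst cpoly_on_gen add_0_right)

lemma forms_vec_mult: "P \<in> forms k J \<Longrightarrow> vec J * P \<in> forms (Suc k) J"
  using forms_mult[OF forms_vec] by simp

lemma forms_norm_sq: "norm_sq J \<in> forms 2 J"
  unfolding norm_sq_eq by (intro forms_sum) (metis forms_mult forms_var one_add_one)

lemma forms_norm_sq_power_mult: "P \<in> forms k J \<Longrightarrow> norm_sq J ^ n * P \<in> forms (2 * n + k) J"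
  by (induction n) (auto simp: mult.assoc dest: forms_mult[OF forms_norm_sq])

lemma lookup_var_partial: "lookup (var j * partial j P) \<alpha> = of_nat (lookup \<alpha> j) * lookup P \<alpha>"
proof (induction P rule: poly_mapping_add_single_induct)
  case (single P \<beta> b)
  have "single j 1 + (\<beta> - single j 1) = \<beta>" if "lookup \<beta> j \<noteq> 0"
    using that by (intro poly_mapping_eqI) (auto simp: lookup_add lookup_minus lookup_single when_def)
  then have "var j * partial j (single \<beta> b) = single \<beta> (of_nat (lookup \<beta> j) * b)"
    by (cases "lookup \<beta> j = 0") (simp_all add: var_def partial_single mult_single)
  with single show ?case
    by (auto simp: partial_add distrib_left lookup_add lookup_single when_def)
qed simp

text \<open>Each x_j \<partial>_j is diagonal on monomials with eigenvalue \<alpha>_j, and these add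
  up to the degree.\<close>

lemma euler:
  assumes "finite J" "P \<in> forms k J"
  shows "(\<Sum>j\<in>J. var j * partial j P) = cscale (of_nat k) P"
proof (rule poly_mapping_eqI)
  fix \<alpha>
  have "lookup P \<alpha> \<noteq> 0 \<Longrightarrow> (\<Sum>j\<in>J. lookup \<alpha> j) = k"
    using assms mdeg_superset[of J \<alpha>] by (auto simp: forms_def cpoly_on_iff homogeneous_iff)
  then show "lookup (\<Sum>j\<in>J. var j * partial j P) \<alpha> = lookup (cscale (of_nat k) P) \<alpha>"
    by (cases "lookup P \<alpha> = 0")
      (simp_all add: lookup_sum lookup_var_partial sum_distrib_right[symmetric] cscale_def
        lookup_cconst_mult of_nat_clifford[symmetric] of_nat_sum[symmetric] del: of_nat_sum)
qed

section \<open>The Dirac and Laplace operators\<close>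

lemma dirac_0 [simp]: "dirac J 0 = 0"
  by (simp add: dirac_def)

lemma dirac_add: "dirac J (P + Q) = dirac J P + dirac J Q"
  by (simp add: dirac_def partial_add distrib_left sum.distrib)

lemma dirac_cscale: "dirac J (cscale c P) = cscale c (dirac J P)"
  by (simp add: dirac_def partial_cscale cscale_mult_right cpoly.scale_sum_right)

lemma dirac_minus: "dirac J (- P) = - dirac J P"
  using dirac_cscale[of J "- 1" P] by simp

lemma dirac_diff: "dirac J (P - Q) = dirac J P - dirac J Q"
  using dirac_add[of J P "- Q"] by (simp add: dirac_minus)

lemma laplace_0 [simp]: "laplace J 0 = 0"
  by (simp add: laplace_def)

lemma laplace_add: "laplace J (P + Q) = laplace J P + laplace J Q"
  by (simp add: laplace_def partial_add sum.distrib)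

lemma laplace_cscale: "laplace J (cscale c P) = cscale c (laplace J P)"
  by (simp add: laplace_def partial_cscale cpoly.scale_sum_right)

lemma forms_dirac: "P \<in> forms k J \<Longrightarrow> dirac J P \<in> forms (k - 1) J"
  unfolding dirac_def
  by (intro forms_sum) (metis add_0 cpoly_on_gen forms_cconst forms_mult forms_partial)

lemma dirac_forms_0: "P \<in> forms 0 J \<Longrightarrow> dirac J P = 0"
  by (simp add: dirac_def forms_zero_partial)

lemma forms_vec_dirac: "P \<in> forms k J \<Longrightarrow> vec J * dirac J P \<in> forms k J"
  by (cases k) (simp add: dirac_forms_0, metis forms_dirac forms_vec_mult diff_Suc_1)

lemma forms_laplace: "P \<in> forms k J \<Longrightarrow> laplace J P \<in> forms (k - 2) J"
  unfolding laplace_def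
  by (intro forms_sum) (metis diff_diff_left forms_partial one_add_one)

lemma laplace_forms_less_2: "P \<in> forms k J \<Longrightarrow> k < 2 \<Longrightarrow> laplace J P = 0"
  unfolding laplace_def
  by (intro sum.neutral ballI forms_zero_partial[of _ J]) (use forms_partial[of P k J] in \<open>cases k; auto\<close>)

text \<open>Since mixed partials are symmetric, twice the double sum contains only the
  anticommutators of the generators, which are -2 on the diagonal and 0 elsewhere.\<close>

lemma dirac_dirac: "dirac J (dirac J P) = - laplace J P"
proof (cases "finite J")
  case True
  have D: "dirac J (dirac J P) = (\<Sum>i\<in>J. \<Sum>j\<in>J. cconst (gen i) * cconst (gen j) * partial i (partial j P))"
    by (simp add: dirac_def partial_sum partial_cconst_mult sum_distrib_left mult.assoc)
  also have "\<dots> = (\<Sum>i\<in>J. \<Sum>j\<in>J. cconst (gen j) * cconst (gen i) * partial i (partial j P))"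
    by (subst sum.swap) (simp add: partial_commute)
  finally have "dirac J (dirac J P) + dirac J (dirac J P)
      = (\<Sum>i\<in>J. \<Sum>j\<in>J. (cconst (gen j) * cconst (gen i) + cconst (gen i) * cconst (gen j)) * partial i (partial j P))"
    by (subst (2) D) (simp add: sum.distrib[symmetric] distrib_right)
  also have "\<dots> = (\<Sum>i\<in>J. \<Sum>j\<in>J. if i = j then cscale (- 2) (partial i (partial j P)) else 0)"
    by (intro sum.cong refl)
      (auto simp: cconst_add[symmetric] cconst_mult[symmetric] gen_anticommute cscale_def)
  also have "\<dots> = cscale (- 2) (laplace J P)"
    using True by (simp add: sum.delta laplace_def cpoly.scale_sum_right del: cpoly.scale_minus_left)
  finally have "cscale 2 (dirac J (dirac J P)) = cscale 2 (- laplace J P)"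
    using cpoly.scale_left_distrib[of 1 1 "dirac J (dirac J P)"] by simp
  then show ?thesis
    by (rule cpoly.scale_left_imp_eq[rotated]) simp
qed (simp add: dirac_def laplace_def)

lemma partial_vec: "finite J \<Longrightarrow> partial j (vec J) = (if j \<in> J then cconst (gen j) else 0)"
  by (simp add: vec_eq partial_sum partial_mult partial_var if_distrib[of "\<lambda>x. x * _"] sum.delta cong: if_cong)

lemma partial_norm_sq: "finite J \<Longrightarrow> partial j (norm_sq J) = (if j \<in> J then cscale 2 (var j) else 0)"
proof -
  assume "finite J"
  have "partial j (var i * var i) = (if i = j then cscale 2 (var j) else 0)" for i
    using cpoly.scale_left_distrib[of 1 1 "var j"] by (auto simp: partial_mult partial_var)
  with \<open>finite J\<close> show ?thesis
    by (simp add: norm_sq_eq partial_sum sum.delta)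
qed

lemma gen_vec:
  assumes "finite J" "j \<in> J"
  shows "cconst (gen j) * vec J = - cscale 2 (var j) - vec J * cconst (gen j)"
proof -
  have "cconst (gen j) * (var i * cconst (gen i))
      = (if i = j then - cscale 2 (var j) else 0) - var i * cconst (gen i) * cconst (gen j)" for i
  proof -
    have "cconst (gen j) * (var i * cconst (gen i)) = var i * (cconst (gen j) * cconst (gen i))"
      by (metis mult.assoc var_commute)
    also have "\<dots> = var i * cconst (cscalar (if j = i then - 2 else 0)) - var i * cconst (gen i) * cconst (gen j)"
      by (subst gen_mult_gen) (simp add: right_diff_distrib mult.assoc)
    finally show ?thesis
      by (auto simp: cscale_def cscalar_uminus cconst_uminus cconst_cscalar_commute)
  qed
  then show ?thesis
    using assms by (simp add: vec_eq sum_distrib_left sum_distrib_right sum_subtractf sum.delta)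
qed

text \<open>Moving \<open>gen j\<close> past the second factor by \<open>gen_vec\<close> reproduces
  the product with the opposite sign, plus -2 x_j^2 for each j.\<close>

lemma vec_vec: "vec J * vec J = - norm_sq J"
proof (cases "finite J")
  case True
  have "vec J * vec J = (\<Sum>j\<in>J. var j * (cconst (gen j) * vec J))"
    by (subst vec_eq) (simp add: sum_distrib_right mult.assoc)
  also have "\<dots> = (\<Sum>j\<in>J. cscale (- 2) (var j * var j) - var j * (vec J * cconst (gen j)))"
    using True by (intro sum.cong refl) (simp add: gen_vec algebra_simps cscale_mult_right)
  also have "\<dots> = cscale (- 2) (norm_sq J) - (\<Sum>j\<in>J. vec J * (var j * cconst (gen j)))"
  proof -
    have "var j * (vec J * cconst (gen j)) = vec J * (var j * cconst (gen j))" for j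
      by (metis mult.assoc var_commute)
    then show ?thesis
      by (simp only: sum_subtractf cpoly.scale_sum_right norm_sq_eq)
  qed
  also have "(\<Sum>j\<in>J. vec J * (var j * cconst (gen j))) = vec J * vec J"
    by (simp add: vec_eq sum_distrib_left)
  finally have "cscale 2 (vec J * vec J) = cscale 2 (- norm_sq J)"
    using cpoly.scale_left_distrib[of 1 1 "vec J * vec J"] by (simp add: algebra_simps)
  then show ?thesis
    by (rule cpoly.scale_left_imp_eq[rotated]) simp
qed (simp add: vec_def norm_sq_def)

text \<open>Differentiating x gives -P for each index. Exchanging \<open>gen j\<close> with x gives
  -2 times the Euler operator and changes the sign of the remaining Dirac term.\<close>

lemma dirac_vec_mult:
  assumes "finite J" "P \<in> forms k J"
  shows "dirac J (vec J * P) = - cscale (of_nat (card J + 2 * k)) P - vec J * dirac J P"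
proof -
  have "dirac J (vec J * P) = (\<Sum>j\<in>J. - P + (cconst (gen j) * vec J) * partial j P)"
    unfolding dirac_def using assms(1)
    by (intro sum.cong refl)
      (simp add: partial_mult partial_vec distrib_left mult.assoc[symmetric] cconst_gen_sq)
  also have "\<dots> = (\<Sum>j\<in>J. - P - cscale 2 (var j * partial j P) - vec J * (cconst (gen j) * partial j P))"
    using assms(1)
    by (intro sum.cong refl) (simp add: gen_vec left_diff_distrib cscale_mult_left mult.assoc)
  also have "\<dots> = - of_nat (card J) * P - cscale 2 (cscale (of_nat k) P) - vec J * dirac J P"
    using euler[OF assms]
    by (simp add: sum_subtractf sum_distrib_left[symmetric] dirac_def cpoly.scale_sum_right[symmetric])
  finally show ?thesis
    by (simp add: of_nat_cscale cpoly.scale_left_distrib)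
qed

lemma dirac_norm_sq_mult:
  assumes "finite J"
  shows "dirac J (norm_sq J * P) = cscale 2 (vec J * P) + norm_sq J * dirac J P"
proof -
  have "cconst (gen j) * (var j * P) = var j * cconst (gen j) * P"
    "cconst (gen j) * (norm_sq J * partial j P) = norm_sq J * (cconst (gen j) * partial j P)" for j
    by (metis mult.assoc var_commute, metis mult.assoc norm_sq_commute)
  then have "dirac J (norm_sq J * P)
      = (\<Sum>j\<in>J. cscale 2 (var j * cconst (gen j) * P) + norm_sq J * (cconst (gen j) * partial j P))"
    unfolding dirac_def using assms
    by (intro sum.cong refl) (simp add: partial_mult partial_norm_sq distrib_left
        cscale_mult_left cscale_mult_right)
  then show ?thesis
    by (simp add: sum.distrib dirac_def vec_eq sum_distrib_left sum_distrib_right cpoly.scale_sum_right)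
qed

lemma dirac_norm_sq_power_mult:
  assumes "finite J"
  shows "dirac J (norm_sq J ^ n * P)
    = cscale (2 * of_nat n) (norm_sq J ^ (n - 1) * (vec J * P)) + norm_sq J ^ n * dirac J P"
proof (induction n)
  case (Suc n)
  have "dirac J (norm_sq J ^ Suc n * P)
      = cscale 2 (norm_sq J ^ n * (vec J * P)) + norm_sq J * dirac J (norm_sq J ^ n * P)"
    by (simp add: mult.assoc dirac_norm_sq_mult[OF assms]) (metis mult.assoc norm_sq_power_commute)
  \<comment> \<open>For n = 0 the truncated exponent n - 1 is met only with the coefficient
    0.\<close>
  also have "norm_sq J * dirac J (norm_sq J ^ n * P)
      = cscale (2 * of_nat n) (norm_sq J ^ n * (vec J * P)) + norm_sq J ^ Suc n * dirac J P"
    unfolding Suc by (cases n) (simp_all add: distrib_left cscale_mult_right mult.assoc)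
  finally show ?case
    by (simp add: cpoly.scale_left_distrib distrib_left)
qed simp

lemma laplace_norm_sq_mult:
  assumes "finite J" "P \<in> forms k J"
  shows "laplace J (norm_sq J * P)
    = cscale (2 * of_nat (card J) + 4 * of_nat k) P + norm_sq J * laplace J P"
proof -
  have "partial j (partial j (norm_sq J * P))
      = cscale 2 P + cscale 4 (var j * partial j P) + norm_sq J * partial j (partial j P)"
    if "j \<in> J" for j
    using that assms(1) cpoly.scale_left_distrib[of 2 2 "var j * partial j P"]
    by (simp add: partial_mult partial_norm_sq partial_add partial_cscale partial_var cscale_mult_left
        cpoly.scale_right_distrib)
  then have "laplace J (norm_sq J * P)
      = of_nat (card J) * cscale 2 P + cscale 4 (cscale (of_nat k) P) + norm_sq J * laplace J P"
    using euler[OF assms]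
    by (simp add: laplace_def sum.distrib sum_distrib_left[symmetric] cpoly.scale_sum_right[symmetric])
  then show ?thesis
    by (simp add: of_nat_cscale cpoly.scale_left_distrib mult.commute)
qed

text \<open>Peeling off one factor |x|^2 at a time contributes 2 m + 4 (2 t + l) for t = 0, ..., n,
  where m is \<open>card J\<close>; the sum is the stated coefficient.\<close>

lemma laplace_norm_sq_power_mult:
  assumes "finite J" "P \<in> forms l J"
  shows "laplace J (norm_sq J ^ Suc n * P)
    = cscale (of_nat (2 * Suc n * (2 * n + 2 * l + card J))) (norm_sq J ^ n * P)
      + norm_sq J ^ Suc n * laplace J P"
proof (induction n)
  case 0
  then show ?case
    using laplace_norm_sq_mult[OF assms] by simp
next
  case (Suc n)
  have "laplace J (norm_sq J ^ Suc (Suc n) * P)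
      = cscale (2 * of_nat (card J) + 4 * of_nat (2 * Suc n + l)) (norm_sq J ^ Suc n * P)
        + norm_sq J * laplace J (norm_sq J ^ Suc n * P)"
    using laplace_norm_sq_mult[OF assms(1) forms_norm_sq_power_mult[OF assms(2)], of "Suc n"]
    by (simp only: power_Suc mult.assoc)
  also have "norm_sq J * laplace J (norm_sq J ^ Suc n * P)
      = cscale (of_nat (2 * Suc n * (2 * n + 2 * l + card J))) (norm_sq J ^ Suc n * P)
        + norm_sq J ^ Suc (Suc n) * laplace J P"
    unfolding Suc by (simp add: distrib_left cscale_mult_right mult.assoc)
  also have "cscale (2 * of_nat (card J) + 4 * of_nat (2 * Suc n + l)) (norm_sq J ^ Suc n * P)
      + (cscale (of_nat (2 * Suc n * (2 * n + 2 * l + card J))) (norm_sq J ^ Suc n * P)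
        + norm_sq J ^ Suc (Suc n) * laplace J P)
    = cscale (of_nat (2 * Suc (Suc n) * (2 * Suc n + 2 * l + card J))) (norm_sq J ^ Suc n * P)
        + norm_sq J ^ Suc (Suc n) * laplace J P"
    unfolding add.assoc[symmetric] cpoly.scale_left_distrib[symmetric]
    by (simp add: algebra_simps)
  finally show ?case .
qed

lemma fischer_inner_norm_sq_mult: "fischer_inner (norm_sq J * P) Q = fischer_inner P (laplace J Q)"
  by (simp add: norm_sq_eq laplace_def sum_distrib_right fischer_inner_sum_left
      fischer_inner_sum_right mult.assoc fischer_inner_var_mult)

text \<open>The sign comes from the conjugation, which sends every generator to its
  negative.\<close>

lemma fischer_inner_vec_mult: "fischer_inner (vec J * P) Q = - fischer_inner P (dirac J Q)"
  by (simp add: vec_eq dirac_def sum_distrib_right fischer_inner_sum_left fischer_inner_sum_right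
      mult.assoc fischer_inner_var_mult fischer_inner_cconst_mult clifford_conj_gen cconst_uminus
      fischer_inner_minus_right sum_negf)

section \<open>Orthogonal splittings\<close>

lemma cpoly_inv_single: "cpoly_inv (single \<alpha> a) = single \<alpha> (main_inv a)"
  by (cases "a = 0") (simp_all add: cpoly_inv_def)

lemma lookup_cpoly_inv: "lookup (cpoly_inv P) \<alpha> = main_inv (lookup P \<alpha>)"
  by (simp add: cpoly_inv_def lookup_sum_single in_keys_iff)

lemma cpoly_inv_add: "cpoly_inv (P + Q) = cpoly_inv P + cpoly_inv Q"
  by (rule poly_mapping_eqI) (simp add: lookup_cpoly_inv lookup_add main_inv_add)

lemma main_inv_blade: "main_inv (blade A) = cscalar (main_sign A) * blade A"
  by (rule clifford_eqI) (auto simp: lookup_main_inv coeffs_simps cmult_single lookup_single when_def)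

lemma gen_mult_blade:
  assumes "j \<notin> fset A"
  shows "gen j * blade A = main_inv (blade A) * gen j"
proof -
  have right: "blade_sign A {|j|} = (\<Prod>a\<in>fset A. if j \<le> a then - 1 else 1)"
    by (simp add: blade_sign_prod)
  have "blade_sign {|j|} A = (\<Prod>a\<in>fset A. if a \<le> j then - 1 else 1)"
    by (simp add: blade_sign_prod)
  \<comment> \<open>As j is not in \<open>A\<close>, exactly one of a \<le> j and j \<le> a holds,
    so the two orders differ by one sign per element of \<open>A\<close>.\<close>
  also have "\<dots> = (\<Prod>a\<in>fset A. - 1 * (if j \<le> a then - 1 else 1))"
    using assms by (intro prod.cong) auto
  also have "\<dots> = main_sign A * blade_sign A {|j|}"
    by (simp only: prod.distrib main_sign_prod right)
  finally show ?thesis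
    by (simp add: gen_def main_inv_blade mult.assoc blade_mult cscalar_mult sdiff_commute[of A])
qed

lemma gen_mult_cpoly_on:
  assumes "P \<in> cpoly_on J" "j \<notin> J"
  shows "cconst (gen j) * P = cpoly_inv P * cconst (gen j)"
  using assms(1)
proof (induction rule: cpoly_on_induct)
  case zero
  then show ?case by (simp add: cpoly_inv_def)
next
  case (add P \<alpha> A c)
  have "gen j * (cscalar c * blade A) = main_inv (cscalar c * blade A) * gen j"
    using gen_mult_blade[of j A] assms(2) add
    by (metis subsetD main_inv_mult main_inv_scalar mult.assoc mult_cscalar_left)
  then have "cconst (gen j) * single \<alpha> (cscalar c * blade A)
      = cpoly_inv (single \<alpha> (cscalar c * blade A)) * cconst (gen j)"
    by (simp add: cconst_def mult_single cpoly_inv_single)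
  with add show ?case
    by (simp add: distrib_left distrib_right cpoly_inv_add)
qed

text \<open>The source of the main involution in the projection formulas: a generator outside
  \<open>U\<close> anticommutes with every generator occurring in P, while the variables are
  central.\<close>

lemma vec_mult_cpoly_on:
  assumes "P \<in> cpoly_on U" "U \<inter> V = {}"
  shows "vec V * P = cpoly_inv P * vec V"
proof -
  have "var j * cconst (gen j) * P = cpoly_inv P * (var j * cconst (gen j))" if "j \<in> V" for j
    using assms that gen_mult_cpoly_on[of P U j] by (metis IntI empty_iff mult.assoc var_commute)
  then show ?thesis
    by (simp add: vec_eq sum_distrib_left sum_distrib_right)
qed

lemma dirac_mult_left:
  assumes "Q \<in> cpoly_on V" "U \<inter> V = {}"
  shows "dirac U (R * Q) = dirac U R * Q"
proof -
  have "partial j (R * Q) = partial j R * Q" if "j \<in> U" for j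
  proof -
    have "j \<notin> V" using that assms(2) by auto
    with assms(1) show ?thesis
      by (simp add: partial_mult partial_add partial_eq_0)
  qed
  then show ?thesis
    by (simp add: dirac_def sum_distrib_right mult.assoc)
qed

lemma dirac_mult_right:
  assumes "R \<in> cpoly_on U" "U \<inter> V = {}"
  shows "dirac V (R * Q) = cpoly_inv R * dirac V Q"
proof -
  have "cconst (gen j) * partial j (R * Q) = cpoly_inv R * (cconst (gen j) * partial j Q)" if "j \<in> V" for j
  proof -
    have "j \<notin> U" using that assms(2) by auto
    with assms(1) show ?thesis
      by (simp add: partial_mult partial_eq_0 gen_mult_cpoly_on flip: mult.assoc)
  qed
  then show ?thesis
    by (simp add: dirac_def sum_distrib_left)
qed

lemma laplace_mult_left:
  assumes "Q \<in> cpoly_on V" "U \<inter> V = {}"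
  shows "laplace U (R * Q) = laplace U R * Q"
proof -
  have "partial j (partial j (R * Q)) = partial j (partial j R) * Q" if "j \<in> U" for j
  proof -
    have "j \<notin> V" using that assms(2) by auto
    with assms(1) show ?thesis
      by (simp add: partial_mult partial_add partial_eq_0)
  qed
  then show ?thesis
    by (simp add: laplace_def sum_distrib_right)
qed

lemma laplace_mult_right:
  assumes "R \<in> cpoly_on U" "U \<inter> V = {}"
  shows "laplace V (R * Q) = R * laplace V Q"
proof -
  have "partial j (partial j (R * Q)) = R * partial j (partial j Q)" if "j \<in> V" for j
  proof -
    have "j \<notin> U" using that assms(2) by auto
    with assms(1) show ?thesis
      by (simp add: partial_mult partial_add partial_eq_0)
  qed
  then show ?thesis
    by (simp add: laplace_def sum_distrib_left)
qed

lemma fischer_inner_single_blade: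
  "fischer_inner (single \<alpha> (cscalar c * blade A)) (single \<beta> (cscalar d * blade B))
    = (if \<alpha> = \<beta> \<and> A = B then of_nat (mfact \<alpha>) * cnj c * d else 0)"
  by (auto simp: fischer_inner_single_left cinner_scalar_left cinner_scalar_right cinner_blade
      lookup_single when_def coeffs_simps cmult_single)

lemma add_eq_add_disjoint_keys_iff:
  fixes \<alpha> \<alpha>' \<beta> \<beta>' :: "nat \<Rightarrow>\<^sub>0 nat"
  assumes "keys \<alpha> \<subseteq> U" "keys \<alpha>' \<subseteq> U" "keys \<beta> \<subseteq> V" "keys \<beta>' \<subseteq> V" "U \<inter> V = {}"
  shows "\<alpha> + \<beta> = \<alpha>' + \<beta>' \<longleftrightarrow> \<alpha> = \<alpha>' \<and> \<beta> = \<beta>'"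
proof
  assume *: "\<alpha> + \<beta> = \<alpha>' + \<beta>'"
  have "lookup \<alpha> j = lookup \<alpha>' j" for j
  proof (cases "j \<in> U")
    case True
    then have "lookup \<beta> j = 0" "lookup \<beta>' j = 0"
      using assms by (auto simp: in_keys_iff)
    then show ?thesis
      using arg_cong[OF *, of "\<lambda>x. lookup x j"] by (simp add: lookup_add)
  next
    case False
    then have "lookup \<alpha> j = 0" "lookup \<alpha>' j = 0"
      using assms by (auto simp: in_keys_iff)
    then show ?thesis by simp
  qed
  then have "\<alpha> = \<alpha>'"
    by (rule poly_mapping_eqI)
  with * show "\<alpha> = \<alpha>' \<and> \<beta> = \<beta>'"
    by simp
qed simp

lemma sdiff_eq_sdiff_disjoint_iff:
  assumes "fset A \<subseteq> U" "fset A' \<subseteq> U" "fset B \<subseteq> V" "fset B' \<subseteq> V" "U \<inter> V = {}"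
  shows "sdiff A B = sdiff A' B' \<longleftrightarrow> A = A' \<and> B = B'"
proof
  assume "sdiff A B = sdiff A' B'"
  then have "fset (sdiff A B) = fset (sdiff A' B')"
    by simp
  moreover have "fset (sdiff A B) = fset A \<union> fset B" "fset (sdiff A' B') = fset A' \<union> fset B'"
    using assms by (auto simp: fset_sdiff)
  ultimately have "fset A = fset A' \<and> fset B = fset B'"
    using assms by blast
  then show "A = A' \<and> B = B'"
    by (simp add: fset_inject)
qed simp

text \<open>Additivity in all four arguments reduces this to monomials times blades. Disjoint
  supports let a product determine its factors, the factorials multiply, and the reordering sign
  occurs twice and cancels.\<close>

lemma fischer_inner_mult_disjoint:
  assumes "P \<in> cpoly_on U" "P' \<in> cpoly_on U" "Q \<in> cpoly_on V" "Q' \<in> cpoly_on V" "U \<inter> V = {}"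
  shows "fischer_inner (P * Q) (P' * Q') = fischer_inner P P' * fischer_inner Q Q'"
  using assms(1)
proof (induction rule: cpoly_on_induct)
  case (add P \<alpha> A a)
  let ?P = "single \<alpha> (cscalar a * blade A)"
  have "fischer_inner (?P * Q) (P' * Q') = fischer_inner ?P P' * fischer_inner Q Q'"
    using assms(2)
  proof (induction rule: cpoly_on_induct)
    case (add P' \<alpha>' A' a')
    let ?P' = "single \<alpha>' (cscalar a' * blade A')"
    have "fischer_inner (?P * Q) (?P' * Q') = fischer_inner ?P ?P' * fischer_inner Q Q'"
      using assms(3)
    proof (induction rule: cpoly_on_induct)
      case (add Q \<beta> B b)
      let ?Q = "single \<beta> (cscalar b * blade B)"
      have "fischer_inner (?P * ?Q) (?P' * Q') = fischer_inner ?P ?P' * fischer_inner ?Q Q'"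
        using assms(4)
      proof (induction rule: cpoly_on_induct)
        case (add Q' \<beta>' B' b')
        let ?Q' = "single \<beta>' (cscalar b' * blade B')"
        have "keys \<alpha> \<inter> keys \<beta> = {}"
          using \<open>keys \<alpha> \<subseteq> U\<close> \<open>keys \<beta> \<subseteq> V\<close> assms(5) by blast
        moreover have "cnj (blade_sign A B) = blade_sign A B"
          by (simp add: blade_sign_def)
        moreover have "\<alpha> + \<beta> = \<alpha>' + \<beta>' \<and> sdiff A B = sdiff A' B'
            \<longleftrightarrow> (\<alpha> = \<alpha>' \<and> A = A') \<and> (\<beta> = \<beta>' \<and> B = B')"
          using add_eq_add_disjoint_keys_iff[of \<alpha> U \<alpha>' \<beta> V \<beta>']
            sdiff_eq_sdiff_disjoint_iff[of A U A' B V B'] assms(5)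
            \<open>keys \<alpha> \<subseteq> U\<close> \<open>keys \<alpha>' \<subseteq> U\<close> \<open>keys \<beta> \<subseteq> V\<close> \<open>keys \<beta>' \<subseteq> V\<close>
            \<open>fset A \<subseteq> U\<close> \<open>fset A' \<subseteq> U\<close> \<open>fset B \<subseteq> V\<close> \<open>fset B' \<subseteq> V\<close>
          by blast
        ultimately have "fischer_inner (?P * ?Q) (?P' * ?Q') = fischer_inner ?P ?P' * fischer_inner ?Q ?Q'"
          unfolding single_blade_mult fischer_inner_single_blade
          using blade_sign_sq[of A B] by (auto simp: mfact_add)
        with add show ?case
          by (simp add: distrib_left fischer_inner_add_right)
      qed simp
      with add show ?case
        by (simp add: distrib_left distrib_right fischer_inner_add_left)
    qed simp
    with add show ?case
      by (simp add: distrib_left distrib_right fischer_inner_add_right)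
  qed simp
  with add show ?case
    by (simp add: distrib_right fischer_inner_add_left)
qed simp

section \<open>The harmonic projection\<close>

lemma harmonics_iff_forms: "P \<in> forms n J \<Longrightarrow> P \<in> harmonics J \<longleftrightarrow> laplace J P = 0"
  by (simp add: harmonics_def forms_def)

lemma laplace_diff: "laplace J (P - Q) = laplace J P - laplace J Q"
  using laplace_add[of J P "- Q"] laplace_cscale[of J "- 1" Q] by simp

text \<open>By adjointness \<langle>h, h\<rangle> = \<langle>r, \<Delta> h\<rangle> = 0; this is the
  uniqueness part of the decomposition.\<close>

lemma laplace_eq_0_imp_eq_0:
  assumes "h = norm_sq J * r" "laplace J h = 0"
  shows "h = 0"
proof -
  have "fischer_inner h h = fischer_inner (norm_sq J * r) h"
    by (rule arg_cong[OF assms(1)])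
  then show ?thesis
    by (simp add: fischer_inner_norm_sq_mult assms(2) fischer_inner_self_eq_0_iff)
qed

text \<open>Prepending h to g by \<open>case_nat\<close> gives a decomposition of f. Two candidates
  for the first component differ by a harmonic multiple of |x|^2, which is 0.\<close>

lemma proj_H_eqI:
  assumes "h \<in> harmonics J" "\<And>s. g s \<in> harmonics J"
    and "f = h + norm_sq J * (\<Sum>s\<le>N. norm_sq J ^ s * g s)"
  shows "proj_H J f = h"
  unfolding proj_H_def
proof (rule the_equality)
  have "f = (\<Sum>s\<le>Suc N. norm_sq J ^ s * case_nat h g s)"
    by (subst sum.atMost_Suc_shift) (simp add: assms(3) sum_distrib_left mult.assoc)
  moreover have "case_nat h g s \<in> harmonics J" for s
    using assms by (cases s) auto
  ultimately show "\<exists>g N. (\<forall>s. g s \<in> harmonics J) \<and> f = (\<Sum>s\<le>N. norm_sq J ^ s * g s) \<and> h = g 0"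
    by (intro exI[of _ "case_nat h g"] exI[of _ "Suc N"]) simp
next
  fix h'
  assume "\<exists>g N. (\<forall>s. g s \<in> harmonics J) \<and> f = (\<Sum>s\<le>N. norm_sq J ^ s * g s) \<and> h' = g 0"
  then obtain g' N' where g': "\<And>s. g' s \<in> harmonics J" "h' = g' 0"
    and f: "f = (\<Sum>s\<le>N'. norm_sq J ^ s * g' s)"
    by blast
  have "f = h' + norm_sq J * (\<Sum>s<N'. norm_sq J ^ s * g' (Suc s))"
    unfolding f g' by (subst sum.atMost_shift) (simp add: sum_distrib_left mult.assoc)
  then have "h' - h = norm_sq J * ((\<Sum>s\<le>N. norm_sq J ^ s * g s) - (\<Sum>s<N'. norm_sq J ^ s * g' (Suc s)))"
    using assms(3) by (simp add: algebra_simps)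
  moreover have "laplace J (h' - h) = 0"
    using assms(1) g' by (simp add: laplace_diff harmonics_def)
  ultimately have "h' - h = 0"
    by (rule laplace_eq_0_imp_eq_0)
  then show "h' = h"
    by simp
qed

text \<open>The divisor is the factor that \<Delta> produces from |x|^(2j+2) times a form of degree
  n - 2j - 2, so the recursion makes the Laplacian of \<open>hproj\<close> telescope.\<close>

primrec hcoeff :: "nat \<Rightarrow> nat \<Rightarrow> nat \<Rightarrow> real" where
  "hcoeff m n 0 = 1"
| "hcoeff m n (Suc j) = - hcoeff m n j / (2 * (real j + 1) * (2 * real n + real m - 4 - 2 * real j))"

text \<open>Summing up to n avoids halving the degree; the terms with 2 j > n are zero.\<close>

definition hproj :: "nat set \<Rightarrow> nat \<Rightarrow> cpoly \<Rightarrow> cpoly" where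
  "hproj J n f = (\<Sum>j\<le>n. cscale (hcoeff (card J) n j) (norm_sq J ^ j * (laplace J ^^ j) f))"

lemma forms_laplace_power: "f \<in> forms n J \<Longrightarrow> (laplace J ^^ j) f \<in> forms (n - 2 * j) J"
proof (induction j)
  case (Suc j)
  then show ?case
    using forms_laplace[of "(laplace J ^^ j) f" "n - 2 * j" J] by simp
qed simp

lemma laplace_power_eq_0: "f \<in> forms n J \<Longrightarrow> n < 2 * j \<Longrightarrow> (laplace J ^^ j) f = 0"
proof (induction j)
  case (Suc j)
  then show ?case
    using forms_laplace_power[of f n J j] laplace_forms_less_2[of "(laplace J ^^ j) f" "n - 2 * j" J]
    by simp
qed simp

lemma laplace_hproj:
  assumes "finite J" "J \<noteq> {}" "f \<in> forms n J"
  shows "laplace J (hproj J n f) = 0"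
proof -
  define c where "c j = complex_of_real (hcoeff (card J) n j)" for j
  define T where "T j = norm_sq J ^ j * (laplace J ^^ Suc j) f" for j
  have m: "card J \<ge> 1"
    using assms by (simp add: Suc_leI card_gt_0_iff)
  have step: "laplace J (cscale (c (Suc j)) (norm_sq J ^ Suc j * (laplace J ^^ Suc j) f))
      = cscale (c (Suc j)) (T (Suc j)) - cscale (c j) (T j)" for j
  proof (cases "2 * Suc j \<le> n")
    case True
    define d where "d = 2 * Suc j * (2 * j + 2 * (n - 2 * Suc j) + card J)"
    obtain t where "n = 2 * Suc j + t"
      using True le_Suc_ex by blast
    then have "real d = 2 * (real j + 1) * (2 * real n + real (card J) - 4 - 2 * real j)"
      by (simp add: d_def algebra_simps)
    moreover have "d \<noteq> 0"
      using m by (simp add: d_def)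
    \<comment> \<open>In this range d is positive because \<open>J\<close> is nonempty, so the
      recursion may be multiplied out.\<close>
    ultimately have "hcoeff (card J) n (Suc j) * real d = - hcoeff (card J) n j"
      by (metis hcoeff.simps(2) nonzero_divide_eq_eq of_nat_eq_0_iff)
    then have "c (Suc j) * of_nat d = - c j"
      unfolding c_def by (metis of_real_minus of_real_mult of_real_of_nat_eq)
    moreover have "laplace J (norm_sq J ^ Suc j * (laplace J ^^ Suc j) f) = cscale (of_nat d) (T j) + T (Suc j)"
      using laplace_norm_sq_power_mult[OF assms(1) forms_laplace_power[OF assms(3)], of j "Suc j"]
      by (simp only: d_def T_def funpow.simps o_apply)
    ultimately show ?thesis
      by (simp add: laplace_cscale cpoly.scale_right_distrib del: funpow.simps power_Suc)
  next
    \<comment> \<open>Here the denominator of \<open>hcoeff\<close> can vanish, but the iterated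
      Laplacian of f is already 0.\<close>
    case False
    then have "(laplace J ^^ Suc j) f = 0" "(laplace J ^^ Suc (Suc j)) f = 0"
      using laplace_power_eq_0[OF assms(3), of "Suc j"] laplace_power_eq_0[OF assms(3), of "Suc (Suc j)"]
      by (simp_all del: funpow.simps)
    then show ?thesis
      by (simp add: T_def del: funpow.simps)
  qed
  \<comment> \<open>The sum telescopes to its last term; for N = n that term contains the Laplacian
    to the power n + 1, which kills f.\<close>
  have "laplace J (\<Sum>j\<le>N. cscale (c j) (norm_sq J ^ j * (laplace J ^^ j) f)) = cscale (c N) (T N)" for N
  proof (induction N)
    case 0
    then show ?case by (simp add: T_def c_def)
  next
    case (Suc N)
    then show ?case
      by (simp add: laplace_add step del: funpow.simps power_Suc)
  qed
  moreover have "T n = 0"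
    using laplace_power_eq_0[OF assms(3), of "Suc n"] by (simp add: T_def)
  ultimately show ?thesis
    by (simp add: hproj_def c_def)
qed

text \<open>The negated tail of \<open>hproj\<close> with one factor |x|^2 removed. Because
  \<open>hcoeff\<close> starts with 1, f splits as in \<open>hproj_hrem\<close> by algebra
  alone.\<close>

definition hrem :: "nat set \<Rightarrow> nat \<Rightarrow> cpoly \<Rightarrow> cpoly" where
  "hrem J n f = - (\<Sum>j<n. cscale (hcoeff (card J) n (Suc j)) (norm_sq J ^ j * (laplace J ^^ Suc j) f))"

lemma hproj_hrem: "f = hproj J n f + norm_sq J * hrem J n f"
  unfolding hproj_def hrem_def
  by (subst sum.atMost_shift)
    (simp add: sum_distrib_left cscale_mult_right mult.assoc del: funpow.simps hcoeff.simps(2))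

lemma forms_hproj: "f \<in> forms n J \<Longrightarrow> hproj J n f \<in> forms n J"
  unfolding hproj_def
proof (intro forms_sum)
  fix j assume f: "f \<in> forms n J"
  show "cscale (hcoeff (card J) n j) (norm_sq J ^ j * (laplace J ^^ j) f) \<in> forms n J"
    using forms_norm_sq_power_mult[OF forms_laplace_power[OF f, of j], of j] laplace_power_eq_0[OF f, of j]
    by (cases "n < 2 * j") (simp_all add: forms_cscale)
qed

lemma forms_hrem: "f \<in> forms n J \<Longrightarrow> hrem J n f \<in> forms (n - 2) J"
  unfolding hrem_def
proof (intro forms_uminus forms_sum)
  fix j assume f: "f \<in> forms n J"
  show "cscale (hcoeff (card J) n (Suc j)) (norm_sq J ^ j * (laplace J ^^ Suc j) f) \<in> forms (n - 2) J"
  proof (cases "n < 2 * Suc j")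
    case True
    then show ?thesis
      using laplace_power_eq_0[OF f, of "Suc j"] by (simp del: funpow.simps)
  next
    case False
    then have "2 * j + (n - 2 * Suc j) = n - 2" by simp
    then show ?thesis
      using forms_norm_sq_power_mult[OF forms_laplace_power[OF f, of "Suc j"], of j]
      by (metis forms_cscale)
  qed
qed

lemma hrem_eq_0: "f \<in> forms n J \<Longrightarrow> n < 2 \<Longrightarrow> hrem J n f = 0"
  using laplace_power_eq_0[of f n J "Suc _"]
  by (simp add: hrem_def sum.neutral del: funpow.simps)

text \<open>Strong induction on the degree: \<open>hproj\<close> supplies the first component and
  \<open>hrem\<close>, of degree n - 2, supplies the others.\<close>

lemma harmonic_decomposition:
  assumes "finite J" "f \<in> forms n J"
  shows "\<exists>g N. (\<forall>s. g s \<in> harmonics J) \<and> f = (\<Sum>s\<le>N. norm_sq J ^ s * g s)"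
  using assms(2)
proof (induction n arbitrary: f rule: less_induct)
  case (less n)
  show ?case
  proof (cases "J = {} \<or> n < 2")
    \<comment> \<open>With no variables, or in degree below 2, f is itself harmonic; elsewhere n - 2
      really is smaller than n.\<close>
    case True
    then have "laplace J f = 0"
      using laplace_forms_less_2[OF less.prems] by (auto simp: laplace_def)
    then have "f \<in> harmonics J"
      using less.prems by (simp add: harmonics_def forms_def)
    then show ?thesis
      by (intro exI[of _ "\<lambda>s. f"] exI[of _ 0]) simp
  next
    case False
    then obtain g N where g: "\<And>s. g s \<in> harmonics J" "hrem J n f = (\<Sum>s\<le>N. norm_sq J ^ s * g s)"
      using less.IH[OF _ forms_hrem[OF less.prems]] by auto
    have h: "hproj J n f \<in> harmonics J"
      using laplace_hproj[OF assms(1) _ less.prems] forms_hproj[OF less.prems] False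
      by (simp add: harmonics_def forms_def)
    have "f = (\<Sum>s\<le>Suc N. norm_sq J ^ s * case_nat (hproj J n f) g s)"
      using hproj_hrem[of f J n]
      by (subst sum.atMost_Suc_shift) (simp add: g(2) sum_distrib_left mult.assoc)
    moreover have "case_nat (hproj J n f) g s \<in> harmonics J" for s
      using g(1) h by (cases s) auto
    ultimately show ?thesis
      by blast
  qed
qed

text \<open>The working form of the projection: it suffices to exhibit f as a harmonic polynomial
  plus a multiple of |x|^2, since the cofactor can be decomposed further.\<close>

lemma proj_H_add_norm_sq_mult:
  assumes "finite J" "h \<in> harmonics J" "r \<in> forms n J"
  shows "proj_H J (h + norm_sq J * r) = h"
proof -
  obtain g N where "\<And>s. g s \<in> harmonics J" "r = (\<Sum>s\<le>N. norm_sq J ^ s * g s)"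
    using harmonic_decomposition[OF assms(1,3)] by blast
  then show ?thesis
    using assms(2) proj_H_eqI by blast
qed

lemma proj_H_eq_hproj:
  assumes "finite J" "J \<noteq> {}" "f \<in> forms n J"
  shows "proj_H J f = hproj J n f"
proof -
  have "hproj J n f \<in> harmonics J"
    using laplace_hproj[OF assms] forms_hproj[OF assms(3)] by (simp add: harmonics_def forms_def)
  then show ?thesis
    using proj_H_add_norm_sq_mult[OF assms(1) _ forms_hrem[OF assms(3)]] hproj_hrem[of f J n] by metis
qed

text \<open>Covers empty \<open>J\<close> too, where \<open>hproj\<close> is not known to be
  harmonic. The clause on n < 2 repairs the truncated degree n - 2 when r is later multiplied by
  x.\<close>

lemma proj_H_split:
  assumes "finite J" "f \<in> forms n J"
  obtains r where "r \<in> forms (n - 2) J" "n < 2 \<longrightarrow> r = 0" "f = proj_H J f + norm_sq J * r"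
    "proj_H J f \<in> forms n J" "laplace J (proj_H J f) = 0"
proof (cases "J = {}")
  case True
  then have "f \<in> harmonics J"
    using assms(2) by (simp add: harmonics_def forms_def laplace_def)
  then have "proj_H J f = f"
    using proj_H_add_norm_sq_mult[OF assms(1), of f 0] by simp
  then show ?thesis
    using that[of 0] assms True by (simp add: laplace_def)
next
  case False
  then show ?thesis
    using that[of "hrem J n f"] assms hproj_hrem[of f J n]
    by (simp add: forms_hrem forms_hproj laplace_hproj proj_H_eq_hproj[OF assms(1) False assms(2)] hrem_eq_0)
qed

lemma harmonics_add: "P \<in> harmonics J \<Longrightarrow> Q \<in> harmonics J \<Longrightarrow> P + Q \<in> harmonics J"
  by (simp add: harmonics_def cpoly_on_add laplace_add)

lemma harmonics_cscale: "P \<in> harmonics J \<Longrightarrow> cscale c P \<in> harmonics J"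
  by (simp add: harmonics_def cpoly_on_cscale laplace_cscale)

lemma proj_H_add:
  assumes "finite J" "f \<in> forms n J" "g \<in> forms n J"
  shows "proj_H J (f + g) = proj_H J f + proj_H J g"
proof -
  obtain r where r: "r \<in> forms (n - 2) J" "f = proj_H J f + norm_sq J * r"
    "proj_H J f \<in> forms n J" "laplace J (proj_H J f) = 0"
    using proj_H_split[OF assms(1,2)] by metis
  obtain r' where r': "r' \<in> forms (n - 2) J" "g = proj_H J g + norm_sq J * r'"
    "proj_H J g \<in> forms n J" "laplace J (proj_H J g) = 0"
    using proj_H_split[OF assms(1,3)] by metis
  have "f + g = proj_H J f + proj_H J g + norm_sq J * (r + r')"
    using r(2) r'(2) by (metis (no_types, lifting) add.assoc add.left_commute distrib_left)
  moreover have "proj_H J f + proj_H J g \<in> harmonics J"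
    using r r' by (intro harmonics_add) (auto simp: harmonics_iff_forms)
  ultimately show ?thesis
    using proj_H_add_norm_sq_mult[OF assms(1) _ forms_add[OF r(1) r'(1)]] by metis
qed

lemma proj_H_cscale:
  assumes "finite J" "f \<in> forms n J"
  shows "proj_H J (cscale c f) = cscale c (proj_H J f)"
proof -
  obtain r where r: "r \<in> forms (n - 2) J" "f = proj_H J f + norm_sq J * r"
    "proj_H J f \<in> forms n J" "laplace J (proj_H J f) = 0"
    using proj_H_split[OF assms] by metis
  have "cscale c f = cscale c (proj_H J f) + norm_sq J * cscale c r"
    using r(2) by (metis cpoly.scale_right_distrib cscale_mult_right)
  moreover have "cscale c (proj_H J f) \<in> harmonics J"
    using r by (intro harmonics_cscale) (auto simp: harmonics_iff_forms)
  ultimately show ?thesis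
    using proj_H_add_norm_sq_mult[OF assms(1) _ forms_cscale[OF r(1)]] by metis
qed

section \<open>The monogenic projection\<close>

lemma monogenics_iff_forms: "P \<in> forms n J \<Longrightarrow> P \<in> monogenics J \<longleftrightarrow> dirac J P = 0"
  by (simp add: monogenics_def forms_def)

lemma dirac_eq_0_imp_eq_0:
  assumes "h = vec J * r" "dirac J h = 0"
  shows "h = 0"
proof -
  have "fischer_inner h h = fischer_inner (vec J * r) h"
    by (rule arg_cong[OF assms(1)])
  then show ?thesis
    by (simp add: fischer_inner_vec_mult assms(2) fischer_inner_self_eq_0_iff)
qed

text \<open>As for \<open>proj_H_eqI\<close>: two candidates differ by a monogenic multiple of x,
  which is orthogonal to itself because x is adjoint to minus the Dirac operator.\<close>

lemma proj_M_eqI: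
  assumes "h \<in> monogenics J" "\<And>s. g s \<in> monogenics J"
    and "f = h + vec J * (\<Sum>s\<le>N. vec J ^ s * g s)"
  shows "proj_M J f = h"
  unfolding proj_M_def
proof (rule the_equality)
  have "f = (\<Sum>s\<le>Suc N. vec J ^ s * case_nat h g s)"
    by (subst sum.atMost_Suc_shift) (simp add: assms(3) sum_distrib_left mult.assoc)
  moreover have "case_nat h g s \<in> monogenics J" for s
    using assms by (cases s) auto
  ultimately show "\<exists>g N. (\<forall>s. g s \<in> monogenics J) \<and> f = (\<Sum>s\<le>N. vec J ^ s * g s) \<and> h = g 0"
    by (intro exI[of _ "case_nat h g"] exI[of _ "Suc N"]) simp
next
  fix h'
  assume "\<exists>g N. (\<forall>s. g s \<in> monogenics J) \<and> f = (\<Sum>s\<le>N. vec J ^ s * g s) \<and> h' = g 0"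
  then obtain g' N' where g': "\<And>s. g' s \<in> monogenics J" "h' = g' 0"
    and f: "f = (\<Sum>s\<le>N'. vec J ^ s * g' s)"
    by blast
  have "f = h' + vec J * (\<Sum>s<N'. vec J ^ s * g' (Suc s))"
    unfolding f g' by (subst sum.atMost_shift) (simp add: sum_distrib_left mult.assoc)
  then have "h' - h = vec J * ((\<Sum>s\<le>N. vec J ^ s * g s) - (\<Sum>s<N'. vec J ^ s * g' (Suc s)))"
    using assms(3) by (simp add: algebra_simps)
  moreover have "dirac J (h' - h) = 0"
    using assms(1) g' by (simp add: dirac_diff monogenics_def)
  ultimately have "h' - h = 0"
    by (rule dirac_eq_0_imp_eq_0)
  then show "h' = h"
    by simp
qed

text \<open>The monogenic part of a harmonic form of degree n. It is applied to arbitrary forms as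
  well, where the result need not be monogenic.\<close>

definition mproj :: "nat set \<Rightarrow> nat \<Rightarrow> cpoly \<Rightarrow> cpoly" where
  "mproj J n h = h + cscale (1 / (2 * real n + real (card J) - 2)) (vec J * dirac J h)"

lemma forms_mproj: "h \<in> forms n J \<Longrightarrow> mproj J n h \<in> forms n J"
  by (simp add: mproj_def forms_add forms_cscale forms_vec_dirac)

text \<open>The only degenerate case \<open>2 n + |J| = 2\<close> with \<open>J \<noteq> {}\<close> is \<open>n = 0\<close>, where \<open>mproj J n h = h\<close>.\<close>

lemma dirac_mproj:
  assumes "finite J" "h \<in> forms n J" "laplace J h = 0"
  shows "dirac J (mproj J n h) = 0"
proof (cases "n = 0 \<or> J = {}")
  case True
  then have "dirac J h = 0"
    using dirac_forms_0 assms(2) by (auto simp: dirac_def)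
  then show ?thesis
    by (simp add: mproj_def)
next
  case False
  define D where "D = 2 * real n + real (card J) - 2"
  have "card J \<ge> 1"
    using False assms(1) by (simp add: Suc_leI card_gt_0_iff)
  with False have "D \<noteq> 0" "real (card J + 2 * (n - 1)) = D"
    by (auto simp: D_def of_nat_diff)
  then have D: "complex_of_real D \<noteq> 0" "of_nat (card J + 2 * (n - 1)) = complex_of_real D"
    by (simp, metis of_real_of_nat_eq)
  \<comment> \<open>The form \<partial>h has degree n - 1 and is monogenic because
    \<partial>\<partial>h = -\<Delta> h = 0, so \<open>dirac_vec_mult\<close> leaves only the factor
    -D.\<close>
  have "dirac J (vec J * dirac J h) = - cscale D (dirac J h)"
    using dirac_vec_mult[OF assms(1) forms_dirac[OF assms(2)]] D(2)
    by (simp only: dirac_dirac assms(3)) simp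
  then show ?thesis
    using D(1) by (simp add: mproj_def dirac_add dirac_cscale flip: D_def)
qed

text \<open>Induction on the degree: after the monogenic part of the harmonic part is removed, the
  rest is x times a form of degree one less.\<close>

lemma monogenic_decomposition:
  assumes "finite J" "f \<in> forms n J"
  shows "\<exists>g N. (\<forall>s. g s \<in> monogenics J) \<and> f = (\<Sum>s\<le>N. vec J ^ s * g s)"
  using assms(2)
proof (induction n arbitrary: f)
  case 0
  then have "f \<in> monogenics J"
    using dirac_forms_0 by (simp add: monogenics_iff_forms)
  then show ?case
    by (intro exI[of _ "\<lambda>s. f"] exI[of _ 0]) simp
next
  case (Suc n)
  obtain r where r: "r \<in> forms (Suc n - 2) J" "Suc n < 2 \<longrightarrow> r = 0" "f = proj_H J f + norm_sq J * r"
    "proj_H J f \<in> forms (Suc n) J" "laplace J (proj_H J f) = 0"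
    using proj_H_split[OF assms(1) Suc.prems] by metis
  define h where "h = proj_H J f"
  define c where "c = complex_of_real (1 / (2 * real (Suc n) + real (card J) - 2))"
  have "vec J * r \<in> forms n J"
    using r(1,2) forms_vec_mult[of r "Suc n - 2" J] by (cases n) auto
  moreover have "dirac J h \<in> forms n J"
    using forms_dirac[OF r(4)] by (simp add: h_def)
  \<comment> \<open>This is the cofactor of x: the first term undoes the correction in
    \<open>mproj\<close>, and the second uses |x|^2 = -x x.\<close>
  ultimately have "- cscale c (dirac J h) - vec J * r \<in> forms n J"
    by (simp add: forms_diff forms_uminus forms_cscale)
  then obtain g N where g: "\<And>s. g s \<in> monogenics J"
    "- cscale c (dirac J h) - vec J * r = (\<Sum>s\<le>N. vec J ^ s * g s)"
    using Suc.IH by blast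
  have "mproj J (Suc n) h \<in> monogenics J"
    using dirac_mproj[OF assms(1) r(4,5)] forms_mproj[OF r(4)] by (simp add: monogenics_iff_forms h_def)
  then have "case_nat (mproj J (Suc n) h) g s \<in> monogenics J" for s
    using g(1) by (cases s) auto
  moreover have "f = mproj J (Suc n) h + vec J * (- cscale c (dirac J h) - vec J * r)"
    using r(3) by (simp add: mproj_def h_def right_diff_distrib vec_vec cscale_mult_right c_def
        flip: mult.assoc)
  then have "f = (\<Sum>s\<le>Suc N. vec J ^ s * case_nat (mproj J (Suc n) h) g s)"
    by (subst sum.atMost_Suc_shift) (simp add: g(2) sum_distrib_left mult.assoc)
  ultimately show ?case
    by blast
qed

lemma proj_M_add_vec_mult:
  assumes "finite J" "h \<in> monogenics J" "r \<in> forms n J"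
  shows "proj_M J (h + vec J * r) = h"
proof -
  obtain g N where "\<And>s. g s \<in> monogenics J" "r = (\<Sum>s\<le>N. vec J ^ s * g s)"
    using monogenic_decomposition[OF assms(1,3)] by blast
  then show ?thesis
    using assms(2) proj_M_eqI by blast
qed

lemma proj_M_eq_mproj:
  assumes "finite J" "f \<in> forms n J"
  shows "proj_M J f = mproj J n (proj_H J f)"
proof -
  obtain r where r: "r \<in> forms (n - 2) J" "n < 2 \<longrightarrow> r = 0" "f = proj_H J f + norm_sq J * r"
    "proj_H J f \<in> forms n J" "laplace J (proj_H J f) = 0"
    using proj_H_split[OF assms] by metis
  define h where "h = proj_H J f"
  define c where "c = complex_of_real (1 / (2 * real n + real (card J) - 2))"
  have "vec J * r \<in> forms (n - 1) J"
  proof (cases "n < 2")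
    case False
    then have "Suc (n - 2) = n - 1" by simp
    with forms_vec_mult[OF r(1)] show ?thesis by (simp only:)
  qed (use r(2) in simp)
  moreover have "dirac J h \<in> forms (n - 1) J"
    using forms_dirac[OF r(4)] by (simp add: h_def)
  ultimately have 1: "- cscale c (dirac J h) - vec J * r \<in> forms (n - 1) J"
    by (simp add: forms_diff forms_uminus forms_cscale)
  have 2: "mproj J n h \<in> monogenics J"
    using dirac_mproj[OF assms(1) r(4,5)] forms_mproj[OF r(4)] by (simp add: monogenics_iff_forms h_def)
  have "f = mproj J n h + vec J * (- cscale c (dirac J h) - vec J * r)"
    using r(3) by (simp add: mproj_def h_def right_diff_distrib vec_vec cscale_mult_right c_def
        flip: mult.assoc)
  then show ?thesis
    using proj_M_add_vec_mult[OF assms(1) 2 1] by (simp add: h_def)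
qed

text \<open>Interchanging the two maps lets x\<partial> be computed on the explicit f instead of on
  its harmonic part.\<close>

lemma proj_M_eq_proj_H:
  assumes "finite J" "f \<in> forms n J"
  shows "proj_M J f = proj_H J (mproj J n f)"
proof -
  obtain r where r: "r \<in> forms (n - 2) J" "f = proj_H J f + norm_sq J * r"
    "proj_H J f \<in> forms n J" "laplace J (proj_H J f) = 0"
    using proj_H_split[OF assms] by metis
  define h where "h = proj_H J f"
  define c where "c = complex_of_real (1 / (2 * real n + real (card J) - 2))"
  have mproj: "mproj J n P = P + cscale c (vec J * dirac J P)" for P
    by (simp only: mproj_def c_def)
  define r' where "r' = r + cscale c (vec J * dirac J r - cscale 2 r)"
  have r': "r' \<in> forms (n - 2) J"
    using r(1) by (simp add: r'_def forms_add forms_cscale forms_diff forms_vec_dirac)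
  have "mproj J n h \<in> forms n J" "dirac J (mproj J n h) = 0"
    using dirac_mproj[OF assms(1) r(3,4)] forms_mproj[OF r(3)] by (simp_all add: h_def)
  \<comment> \<open>Monogenic forms are harmonic, so \<open>mproj J n h\<close> is fixed by the
    harmonic projection.\<close>
  then have harm: "mproj J n h \<in> harmonics J"
    using dirac_dirac[of J "mproj J n h"] by (simp add: harmonics_iff_forms)
  have "vec J * dirac J (norm_sq J * r) = norm_sq J * (vec J * dirac J r - cscale 2 r)"
  proof -
    have "vec J * (norm_sq J * dirac J r) = norm_sq J * (vec J * dirac J r)"
      by (metis mult.assoc norm_sq_commute)
    moreover have "vec J * (vec J * r) = - (norm_sq J * r)"
      by (simp add: vec_vec flip: mult.assoc)
    ultimately show ?thesis
      by (simp add: dirac_norm_sq_mult[OF assms(1)] distrib_left right_diff_distrib cscale_mult_right)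
  qed
  moreover have "f = h + norm_sq J * r"
    using r(2) by (simp add: h_def)
  ultimately have "mproj J n f = mproj J n h + norm_sq J * r'"
    by (simp add: mproj dirac_add distrib_left r'_def cpoly.scale_right_distrib cscale_mult_right)
  then show ?thesis
    using proj_H_add_norm_sq_mult[OF assms(1) harm r'] proj_M_eq_mproj[OF assms] by (simp add: h_def)
qed

lemma proj_H_lincomb:
  assumes "finite J" "f \<in> forms n J" "g \<in> forms n J"
  shows "proj_H J (cscale c (cscale a f - cscale b g)) = cscale c (cscale a (proj_H J f) - cscale b (proj_H J g))"
proof -
  have "proj_H J (cscale c (cscale a f + cscale (- b) g))
      = cscale c (cscale a (proj_H J f) + cscale (- b) (proj_H J g))"
    using assms by (simp only: proj_H_cscale[of J _ n] proj_H_add[of J _ n] forms_add forms_cscale)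
  then show ?thesis
    by simp
qed

lemma proj_M_0: "finite J \<Longrightarrow> proj_M J 0 = 0"
  using proj_M_add_vec_mult[of J 0 0] by (simp add: monogenics_def)

lemma proj_M_cscale:
  assumes "finite J" "f \<in> forms n J"
  shows "proj_M J (cscale c f) = cscale c (proj_M J f)"
  using assms
  by (simp add: proj_M_eq_mproj[of J _ n] forms_cscale proj_H_cscale[of J _ n] mproj_def dirac_cscale
      cscale_mult_right cpoly.scale_right_distrib mult.commute)

section \<open>Squared norms of the two projections\<close>

lemma fischer_norm_sq_proj_M:
  assumes "finite J" "f \<in> forms n J"
  shows "fischer_norm_sq (proj_M J f) = fischer_norm_sq (proj_H J f)
    - of_real (1 / (2 * real n + real (card J) - 2)) * fischer_norm_sq (proj_M J (dirac J f))"
proof -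
  obtain r where r: "r \<in> forms (n - 2) J" "f = proj_H J f + norm_sq J * r"
    "proj_H J f \<in> forms n J" "laplace J (proj_H J f) = 0"
    using proj_H_split[OF assms] by metis
  define h where "h = proj_H J f"
  define c where "c = complex_of_real (1 / (2 * real n + real (card J) - 2))"
  define M where "M = proj_M J f"
  have M: "M = h + cscale c (vec J * dirac J h)"
    using proj_M_eq_mproj[OF assms] by (simp only: M_def h_def c_def mproj_def)
  have "dirac J M = 0"
    using dirac_mproj[OF assms(1) r(3,4)] proj_M_eq_mproj[OF assms] by (simp only: M_def)
  \<comment> \<open>The monogenic part is orthogonal to every multiple of x, so one copy of M may be
    replaced by h.\<close>
  then have "fischer_inner (vec J * dirac J h) M = 0"
    by (simp add: fischer_inner_vec_mult)
  then have "fischer_inner M (vec J * dirac J h) = 0"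
    by (metis complex_cnj_zero fischer_inner_commute)
  then have "fischer_inner M M = fischer_inner M h"
    by (subst (2) M) (simp add: fischer_inner_add_right fischer_inner_cscale_right)
  also have "\<dots> = fischer_inner h h - c * fischer_inner (dirac J h) (dirac J h)"
    by (subst M) (simp add: fischer_inner_add_left fischer_inner_cscale_left fischer_inner_vec_mult c_def)
  also have "dirac J h = proj_M J (dirac J f)"
  proof -
    have f: "f = h + norm_sq J * r"
      using r(2) by (simp add: h_def)
    \<comment> \<open>The Dirac derivative of |x|^2 r is x (2 r - x\<partial>r), so it does not
      affect the monogenic projection, and \<partial>h is monogenic.\<close>
    have "dirac J f = dirac J h + vec J * (cscale 2 r - vec J * dirac J r)"
      by (subst f) (simp add: dirac_add dirac_norm_sq_mult[OF assms(1)] right_diff_distrib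
          cscale_mult_right vec_vec flip: mult.assoc)
    moreover have "dirac J h \<in> monogenics J"
      using forms_dirac[OF r(3)] r(4) by (simp add: h_def monogenics_iff_forms dirac_dirac)
    moreover have "cscale 2 r - vec J * dirac J r \<in> forms (n - 2) J"
      using r(1) by (simp add: forms_diff forms_cscale forms_vec_dirac)
    ultimately show ?thesis
      using proj_M_add_vec_mult[OF assms(1)] by simp
  qed
  finally show ?thesis
    by (simp only: M_def h_def c_def)
qed

lemma fischer_norm_sq_proj_M_if_dirac_eq:
  assumes "finite J" "f \<in> forms n J" "g \<in> forms l J" "dirac J f = cscale (of_real c) g"
  shows "fischer_norm_sq (proj_M J f) = fischer_norm_sq (proj_H J f)
    - of_real (c\<^sup>2 / (2 * real n + real (card J) - 2)) * fischer_norm_sq (proj_M J g)"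
  unfolding fischer_norm_sq_proj_M[OF assms(1,2)] assms(4) proj_M_cscale[OF assms(1,3)]
  by (simp add: fischer_inner_cscale_left fischer_inner_cscale_right power2_eq_square)

text \<open>The projection is orthogonal: a harmonic polynomial is perpendicular to every multiple
  of |x|^2.\<close>

lemma fischer_norm_sq_proj_H:
  assumes "finite J" "f \<in> forms n J"
  shows "fischer_norm_sq (proj_H J f) = fischer_inner (proj_H J f) f"
proof -
  obtain r where r: "f = proj_H J f + norm_sq J * r" "laplace J (proj_H J f) = 0"
    using proj_H_split[OF assms] by metis
  have "fischer_inner (proj_H J f) (norm_sq J * r) = cnj (fischer_inner (norm_sq J * r) (proj_H J f))"
    by (rule fischer_inner_commute)
  also have "\<dots> = 0"
    by (simp add: fischer_inner_norm_sq_mult r(2))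
  finally show ?thesis
    using arg_cong[OF r(1), of "fischer_inner (proj_H J f)"] by (simp add: fischer_inner_add_right)
qed

lemma fischer_inner_norm_sq_power_mult:
  "fischer_inner (norm_sq J ^ j * P) Q = fischer_inner P ((laplace J ^^ j) Q)"
  by (induction j arbitrary: Q)
    (simp_all add: mult.assoc fischer_inner_norm_sq_mult funpow_Suc_right del: funpow.simps)

section \<open>Closed forms of the coefficients\<close>

lemma prod_descending_eq_pochhammer: "(\<Prod>l<s. a + real s - 1 - real l) = pochhammer a s"
proof -
  have "(\<Prod>l<s. a + real s - 1 - real l) = (\<Prod>l<s. a + real l)"
    by (subst prod.nat_diff_reindex[symmetric]) (intro prod.cong refl, simp add: of_nat_diff)
  then show ?thesis
    by (simp add: pochhammer_prod lessThan_atLeast0)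
qed

lemma hcoeff_eq: "hcoeff m n j = (- 1) ^ j / (4 ^ j * fact j * (\<Prod>l<j. real n + real m / 2 - 2 - real l))"
proof (induction j)
  case (Suc j)
  have "2 * real n + real m - 4 - 2 * real j = 2 * (real n + real m / 2 - 2 - real j)"
    by simp
  with Suc show ?case
    by (simp add: algebra_simps)
qed simp

text \<open>The scalar by which \<Delta>^s sends |u|^(2s) A to A, for A harmonic of degree k in p
  variables.\<close>

primrec lcoeff :: "nat \<Rightarrow> nat \<Rightarrow> nat \<Rightarrow> real" where
  "lcoeff p k 0 = 1"
| "lcoeff p k (Suc s) = real (2 * Suc s * (2 * s + 2 * k + p)) * lcoeff p k s"

lemma lcoeff_eq: "lcoeff p k s = 4 ^ s * fact s * pochhammer (real k + real p / 2) s"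
  by (induction s) (simp_all add: pochhammer_Suc algebra_simps)

lemma hcoeff_lcoeff:
  "(- 1) ^ s * hcoeff (p + q) (2 * s + k + i) s * lcoeff p k s * lcoeff q i s = fischer_c s k i p q"
proof -
  \<comment> \<open>In degree 2 s + k + i the descending product in \<open>hcoeff_eq\<close> has as
    its smallest factor the base of the rising factorial in \<open>fischer_c\<close>.\<close>
  have "(\<Prod>l<s. real (2 * s + k + i) + real (p + q) / 2 - 2 - real l)
      = (\<Prod>l<s. (real s + real k + real i + (real (p + q) - 2) / 2) + real s - 1 - real l)"
    by (intro prod.cong refl) (simp add: field_simps)
  then have "hcoeff (p + q) (2 * s + k + i) s = (- 1) ^ s
      / (4 ^ s * fact s * pochhammer (real s + real k + real i + (real (p + q) - 2) / 2) s)"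
    by (simp only: hcoeff_eq prod_descending_eq_pochhammer)
  then show ?thesis
    by (simp add: fischer_c_def lcoeff_eq power_mult_distrib[symmetric])
qed

text \<open>Stated for an abstract family so that it serves both |u|^(2s) A B and |v|^(2s) A
  B.\<close>

lemma laplace_power_chain:
  assumes step: "\<And>s. laplace J (F (Suc s)) = cscale (of_nat (2 * Suc s * (2 * s + 2 * k + p))) (F s)"
  shows "(laplace J ^^ s) (F s) = cscale (lcoeff p k s) (F 0)"
    and "\<exists>c. (laplace J ^^ s) (F (t + s)) = cscale c (F t)"
proof -
  have cscale_power: "(laplace J ^^ s) (cscale c P) = cscale c ((laplace J ^^ s) P)" for s c P
    by (induction s) (simp_all add: laplace_cscale)
  show "(laplace J ^^ s) (F s) = cscale (lcoeff p k s) (F 0)"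
  proof (induction s)
    case (Suc s)
    have "(laplace J ^^ Suc s) (F (Suc s))
        = cscale (of_nat (2 * Suc s * (2 * s + 2 * k + p)) * of_real (lcoeff p k s)) (F 0)"
      by (simp only: funpow_Suc_right o_apply step cscale_power Suc cpoly.scale_scale)
    then show ?case
      by (simp only: lcoeff.simps of_real_mult of_real_of_nat_eq)
  qed simp
  show "\<exists>c. (laplace J ^^ s) (F (t + s)) = cscale c (F t)"
  proof (induction s)
    case 0
    show ?case by (intro exI[of _ 1]) simp
  next
    case (Suc s)
    then obtain c where "(laplace J ^^ s) (F (t + s)) = cscale c (F t)"
      by blast
    then show ?case
      by (simp only: funpow_Suc_right o_apply step cscale_power cpoly.scale_scale add_Suc_right) blast
  qed
qed

section \<open>Polynomials on a direct sum\<close>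

locale orthogonal_split =
  fixes U V :: "nat set"
  assumes finite_U: "finite U" and finite_V: "finite V" and disjoint: "U \<inter> V = {}"
begin

lemma finite_Un: "finite (U \<union> V)"
  by (simp add: finite_U finite_V)

lemma card_Un: "card (U \<union> V) = card U + card V"
  by (rule card_Un_disjoint[OF finite_U finite_V disjoint])

lemma vec_Un: "vec (U \<union> V) = vec U + vec V"
  by (simp add: vec_def sum.union_disjoint finite_U finite_V disjoint)

lemma norm_sq_Un: "norm_sq (U \<union> V) = norm_sq U + norm_sq V"
  by (simp add: norm_sq_def sum.union_disjoint finite_U finite_V disjoint)

lemma dirac_Un: "dirac (U \<union> V) P = dirac U P + dirac V P"
  by (simp add: dirac_def sum.union_disjoint finite_U finite_V disjoint)

lemma laplace_Un: "laplace (U \<union> V) P = laplace U P + laplace V P"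
  by (simp add: laplace_def sum.union_disjoint finite_U finite_V disjoint)

lemma forms_mult_Un: "A \<in> forms k U \<Longrightarrow> B \<in> forms i V \<Longrightarrow> A * B \<in> forms (k + i) (U \<union> V)"
  by (rule forms_mult) (auto intro: forms_mono)

lemma laplace_mult_harmonic:
  assumes "R \<in> forms l U" "B \<in> forms i V" "laplace V B = 0"
  shows "laplace (U \<union> V) (R * B) = laplace U R * B"
  using assms disjoint laplace_mult_left[of B V U R] laplace_mult_right[of R U V B]
  by (simp add: laplace_Un forms_def)

lemma laplace_norm_sq_power_mult_harmonic:
  assumes "A \<in> forms k U" "laplace U A = 0" "B \<in> forms i V" "laplace V B = 0"
  shows "laplace (U \<union> V) (norm_sq U ^ Suc s * A * B)
    = cscale (of_nat (2 * Suc s * (2 * s + 2 * k + card U))) (norm_sq U ^ s * A * B)"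
  using laplace_mult_harmonic[OF forms_norm_sq_power_mult[OF assms(1)] assms(3,4), of "Suc s"]
    laplace_norm_sq_power_mult[OF finite_U assms(1), of s] assms(2)
  by (simp only: cscale_mult_left mult_zero_right add_0_right)

lemma norm_sq_V_power_mult:
  "norm_sq V ^ s * A * B = A * (norm_sq V ^ s * B)"
  by (metis mult.assoc norm_sq_power_commute)

lemma laplace_norm_sq_power_mult_harmonic':
  assumes "A \<in> forms k U" "laplace U A = 0" "B \<in> forms i V" "laplace V B = 0"
  shows "laplace (U \<union> V) (norm_sq V ^ Suc s * A * B)
    = cscale (of_nat (2 * Suc s * (2 * s + 2 * i + card V))) (norm_sq V ^ s * A * B)"
proof -
  have "norm_sq V ^ Suc s * B \<in> cpoly_on V" "A \<in> cpoly_on U"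
    using forms_norm_sq_power_mult[OF assms(3), of "Suc s"] assms(1) by (simp_all add: forms_def)
  then have "laplace (U \<union> V) (A * (norm_sq V ^ Suc s * B)) = A * laplace V (norm_sq V ^ Suc s * B)"
    using laplace_mult_left[of _ V U A] laplace_mult_right[of A U V] disjoint assms(2)
    by (simp add: laplace_Un)
  then show ?thesis
    unfolding norm_sq_V_power_mult laplace_norm_sq_power_mult[OF finite_V assms(3)]
    by (simp only: cscale_mult_right assms(4) mult_zero_right add_0_right)
qed

section \<open>Norm of the harmonic part of a product of harmonics\<close>

lemma fischer_inner_harmonic_norm_sq_power:
  assumes "laplace (U \<union> V) h = 0"
  shows "fischer_inner h (norm_sq U ^ s * R) = (- 1) ^ s * fischer_inner h (norm_sq V ^ s * R)"
proof (induction s arbitrary: R)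
  case (Suc s)
  \<comment> \<open>The sum of |u|^2 and |v|^2 is |x|^2, whose multiples are orthogonal to
    h.\<close>
  have swap: "fischer_inner h (norm_sq U * R) = - fischer_inner h (norm_sq V * R)" for R
  proof -
    have "fischer_inner (norm_sq (U \<union> V) * R) h = 0"
      by (simp add: fischer_inner_norm_sq_mult assms)
    then have "fischer_inner h (norm_sq (U \<union> V) * R) = 0"
      by (metis complex_cnj_zero fischer_inner_commute)
    then show ?thesis
      by (simp add: norm_sq_Un distrib_right fischer_inner_add_right eq_neg_iff_add_eq_0)
  qed
  have "fischer_inner h (norm_sq U ^ Suc s * R) = - fischer_inner h (norm_sq V * (norm_sq U ^ s * R))"
    by (simp add: mult.assoc swap)
  also have "norm_sq V * (norm_sq U ^ s * R) = norm_sq U ^ s * (norm_sq V * R)"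
    by (metis mult.assoc norm_sq_commute)
  also have "- fischer_inner h \<dots> = (- 1) ^ Suc s * fischer_inner h (norm_sq V ^ s * (norm_sq V * R))"
    by (simp add: Suc)
  finally show ?case
    by (simp only: power_Suc2 mult.assoc)
qed simp

text \<open>For j = s both chains end in a multiple of A B. For j < s a factor |u|^2 remains on the
  left, and its adjoint kills the right side. For j > s the left side is already 0.\<close>

lemma fischer_inner_laplace_powers:
  assumes "A \<in> forms k U" "laplace U A = 0" "B \<in> forms i V" "laplace V B = 0"
  shows "fischer_inner ((laplace (U \<union> V) ^^ j) (norm_sq U ^ s * A * B))
      ((laplace (U \<union> V) ^^ j) (norm_sq V ^ s * A * B))
    = (if j = s then of_real (lcoeff (card U) k s * lcoeff (card V) i s)
         * fischer_norm_sq A * fischer_norm_sq B else 0)"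
proof -
  have AB: "A \<in> cpoly_on U" "B \<in> cpoly_on V"
    using assms by (simp_all add: forms_def)
  note chain = laplace_power_chain[where F = "\<lambda>s. norm_sq U ^ s * A * B",
      OF laplace_norm_sq_power_mult_harmonic[OF assms]]
  note chain' = laplace_power_chain[where F = "\<lambda>s. norm_sq V ^ s * A * B",
      OF laplace_norm_sq_power_mult_harmonic'[OF assms]]
  consider "j = s" | "j < s" | "j > s" by linarith
  then show ?thesis
  proof cases
    case 1
    then show ?thesis
      using chain(1)[of s] chain'(1)[of s] fischer_inner_mult_disjoint[OF AB(1) AB(1) AB(2) AB(2) disjoint]
      by (simp add: fischer_inner_cscale_left fischer_inner_cscale_right)
  next
    case 2
    then obtain t where t: "s = Suc t + j"
      by (metis add.commute add_Suc_right less_imp_Suc_add)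
    obtain c d where cd: "(laplace (U \<union> V) ^^ j) (norm_sq U ^ s * A * B) = cscale c (norm_sq U ^ Suc t * A * B)"
      "(laplace (U \<union> V) ^^ j) (norm_sq V ^ s * A * B) = cscale d (norm_sq V ^ Suc t * A * B)"
      using chain(2)[of j "Suc t"] chain'(2)[of j "Suc t"] unfolding t by blast
    have "norm_sq V ^ Suc t * B \<in> cpoly_on V"
      using forms_norm_sq_power_mult[OF assms(3), of "Suc t"] by (simp add: forms_def)
    then have "laplace U (norm_sq V ^ Suc t * A * B) = 0"
      \<comment> \<open>The right argument depends on the variables of \<open>U\<close> only through
        the harmonic factor A.\<close>
      unfolding norm_sq_V_power_mult using laplace_mult_left[of _ V U A] disjoint assms(2) by simp
    then have "fischer_inner (norm_sq U ^ Suc t * A * B) (norm_sq V ^ Suc t * A * B) = 0"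
      by (simp add: mult.assoc fischer_inner_norm_sq_mult)
    with 2 cd show ?thesis
      by (simp add: fischer_inner_cscale_left fischer_inner_cscale_right)
  next
    case 3
    then obtain t where t: "j = Suc t + s"
      by (metis add.commute add_Suc_right less_imp_Suc_add)
    have "laplace (U \<union> V) (A * B) = 0"
      using laplace_mult_harmonic[OF assms(1,3,4)] assms(2) by simp
    moreover have "(laplace J ^^ t) 0 = 0" for J
      by (induction t) simp_all
    ultimately have "(laplace (U \<union> V) ^^ j) (norm_sq U ^ s * A * B) = 0"
      unfolding t funpow_add o_apply chain(1) by (simp add: laplace_cscale funpow_Suc_right del: funpow.simps)
    with 3 show ?thesis by simp
  qed
qed

lemma fischer_norm_sq_proj_H_split:
  assumes "U \<union> V \<noteq> {}" "A \<in> forms k U" "laplace U A = 0" "B \<in> forms i V" "laplace V B = 0"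
  shows "fischer_norm_sq (proj_H (U \<union> V) (norm_sq U ^ s * A * B))
    = of_real (fischer_c s k i (card U) (card V)) * fischer_norm_sq A * fischer_norm_sq B"
proof -
  define X where "X = U \<union> V"
  define n where "n = 2 * s + k + i"
  define f where "f = norm_sq U ^ s * A * B"
  have f: "f \<in> forms n X"
    unfolding f_def n_def X_def
    by (intro forms_mult_Un forms_norm_sq_power_mult assms)
  have X: "finite X" "X \<noteq> {}"
    using assms(1) finite_Un by (simp_all add: X_def)
  have harmonic: "laplace X (proj_H X f) = 0"
    using laplace_hproj[OF X f] proj_H_eq_hproj[OF X f] by simp
  have "fischer_norm_sq (proj_H X f) = fischer_inner (proj_H X f) (norm_sq U ^ s * (A * B))"
    using fischer_norm_sq_proj_H[OF X(1) f] by (simp add: f_def mult.assoc)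
  also have "\<dots> = (- 1) ^ s * fischer_inner (proj_H X f) (norm_sq V ^ s * A * B)"
    using fischer_inner_harmonic_norm_sq_power[of "proj_H X f"] harmonic by (simp add: X_def mult.assoc)
  \<comment> \<open>The projection is expanded explicitly, and each |x|^(2j) is moved to the other
    side as \<Delta>^j.\<close>
  also have "fischer_inner (proj_H X f) (norm_sq V ^ s * A * B)
      = (\<Sum>j\<le>n. of_real (hcoeff (card X) n j)
          * fischer_inner ((laplace X ^^ j) f) ((laplace X ^^ j) (norm_sq V ^ s * A * B)))"
    unfolding proj_H_eq_hproj[OF X f] hproj_def
    by (simp add: fischer_inner_sum_left fischer_inner_cscale_left fischer_inner_norm_sq_power_mult)
  also have "\<dots> = (\<Sum>j\<le>n. if j = s then of_real (hcoeff (card X) n s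
      * lcoeff (card U) k s * lcoeff (card V) i s) * fischer_norm_sq A * fischer_norm_sq B else 0)"
    unfolding f_def X_def fischer_inner_laplace_powers[OF assms(2-5)]
    by (intro sum.cong refl) simp
  also have "\<dots> = of_real (hcoeff (card X) n s * lcoeff (card U) k s * lcoeff (card V) i s)
      * fischer_norm_sq A * fischer_norm_sq B"
    by (simp add: n_def)
  also have "(- 1) ^ s * \<dots> = of_real ((- 1) ^ s * hcoeff (card X) n s * lcoeff (card U) k s * lcoeff (card V) i s)
      * fischer_norm_sq A * fischer_norm_sq B"
    by simp
  also have "(- 1) ^ s * hcoeff (card X) n s * lcoeff (card U) k s * lcoeff (card V) i s
      = fischer_c s k i (card U) (card V)"
    unfolding X_def card_Un n_def by (rule hcoeff_lcoeff)
  finally show ?thesis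
    by (simp only: f_def X_def)
qed

end

subsection \<open>Monogenic factors\<close>

lemma laplace_monogenic: "dirac J P = 0 \<Longrightarrow> laplace J P = 0"
  by (metis add.inverse_neutral dirac_0 dirac_dirac minus_minus)

lemma dirac_vec_monogenic:
  "finite J \<Longrightarrow> P \<in> forms k J \<Longrightarrow> dirac J P = 0
    \<Longrightarrow> dirac J (vec J * P) = - cscale (of_nat (card J + 2 * k)) P"
  by (simp only: dirac_vec_mult mult_zero_right diff_zero)

text \<open>The Dirac derivative of x P is a multiple of P, so the second one vanishes. This lets u
  P act as a harmonic factor of degree k + 1.\<close>

lemma laplace_vec_monogenic:
  "finite J \<Longrightarrow> P \<in> forms k J \<Longrightarrow> dirac J P = 0 \<Longrightarrow> laplace J (vec J * P) = 0"
  using dirac_dirac[of J "vec J * P"]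
  by (simp only: dirac_vec_monogenic dirac_minus dirac_cscale) simp

lemma fischer_norm_sq_vec_monogenic:
  "finite J \<Longrightarrow> P \<in> forms k J \<Longrightarrow> dirac J P = 0
    \<Longrightarrow> fischer_norm_sq (vec J * P) = of_nat (card J + 2 * k) * fischer_norm_sq P"
  by (simp only: fischer_inner_vec_mult dirac_vec_monogenic fischer_inner_minus_right
      fischer_inner_cscale_right minus_minus)

lemma cpoly_inv_0 [simp]: "cpoly_inv 0 = 0"
  by (simp add: cpoly_inv_def)

lemma forms_cpoly_inv: "P \<in> forms k J \<Longrightarrow> cpoly_inv P \<in> forms k J"
proof -
  have "lookup P \<alpha> \<noteq> 0" if "lookup (cpoly_inv P) \<alpha> \<noteq> 0" for \<alpha>
    using that by (metis lookup_cpoly_inv main_inv_zero)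
  moreover have "main_inv a \<in> clifford_on J" if "a \<in> clifford_on J" for a
    using that by (simp add: clifford_on_iff lookup_main_inv)
  ultimately show "P \<in> forms k J \<Longrightarrow> cpoly_inv P \<in> forms k J"
    by (simp add: forms_def cpoly_on_iff homogeneous_iff) (simp add: lookup_cpoly_inv)
qed

lemma cpoly_inv_vec: "cpoly_inv (vec J) = - vec J"
proof -
  have "cpoly_inv (sum f S) = (\<Sum>x\<in>S. cpoly_inv (f x))" for f and S :: "nat set"
    by (induction S rule: infinite_finite_induct) (simp_all add: cpoly_inv_add)
  then show ?thesis
    by (simp add: vec_def cpoly_inv_single main_inv_gen single_uminus sum_negf)
qed

text \<open>The factor in the squared norm of the monogenic projection of \<open>|u|\<^bsup>2s\<^esup> P Q\<close>, in a form
  without the removable singularity at \<open>2 (2 s + k + i) + m = 2\<close>.\<close>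

definition fischer_a :: "nat \<Rightarrow> nat \<Rightarrow> nat \<Rightarrow> nat \<Rightarrow> nat \<Rightarrow> real" where
  "fischer_a s k i p q = 4 ^ s * fact s * pochhammer (real k + real p / 2) s
     * pochhammer (real i + real q / 2) s / pochhammer (real s + real k + real i + real (p + q) / 2) s"

text \<open>The arithmetic of the norm recursion from the odd family at s to the even family at s +
  1.\<close>

lemma fischer_a_Suc:
  assumes "p + q > 0"
  shows "fischer_a (Suc s) k i p q = fischer_c (Suc s) k i p q
    - (2 * real (Suc s))\<^sup>2 / (2 * real (2 * Suc s + k + i) + real (p + q) - 2)
      * (fischer_c (Suc s) k i p q / (2 * real (Suc s)))"
proof -
  define N where "N = real k + real i + real (p + q) / 2"
  define Y where "Y = 4 ^ Suc s * fact (Suc s) * pochhammer (real k + real p / 2) (Suc s)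
     * pochhammer (real i + real q / 2) (Suc s)"
  define T where "T = pochhammer (N + real s) (Suc s)"
  have "real (p + q) > 0"
    using assms by (simp only: of_nat_0_less_iff)
  then have N: "N > 0"
    unfolding N_def by (intro add_nonneg_pos) simp_all
  have T: "T \<noteq> 0"
    using pochhammer_pos[of "N + real s" "Suc s"] N by (simp add: T_def)
  have c: "fischer_c (Suc s) k i p q = Y / T"
    by (simp add: fischer_c_def Y_def T_def N_def field_simps)
  \<comment> \<open>Both sides equal the rising factorial of N + s with s + 2 factors.\<close>
  have "pochhammer (N + real s + 1) (Suc s) * (N + real s) = T * (N + 2 * real s + 1)"
    using pochhammer_rec[of "N + real s" "Suc s"] pochhammer_Suc[of "N + real s" "Suc s"]
    by (simp add: T_def algebra_simps)
  moreover have "Y / pochhammer (N + real s + 1) (Suc s)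
      = Y * (N + real s) / (pochhammer (N + real s + 1) (Suc s) * (N + real s))"
    using N by simp
  ultimately have "Y / pochhammer (N + real s + 1) (Suc s) = Y * (N + real s) / (T * (N + 2 * real s + 1))"
    by (simp only:)
  moreover have "fischer_a (Suc s) k i p q = Y / pochhammer (N + real s + 1) (Suc s)"
    by (simp add: fischer_a_def Y_def N_def algebra_simps)
  moreover have "2 * real (2 * Suc s + k + i) + real (p + q) - 2 = 2 * (N + 2 * real s + 1)"
    by (simp add: N_def)
  moreover have "Y / T - (2 * real (Suc s))\<^sup>2 / (2 * (N + 2 * real s + 1)) * (Y / T / (2 * real (Suc s)))
      = Y * (N + real s) / (T * (N + 2 * real s + 1))"
  proof -
    \<comment> \<open>Used with e = 2 (s + 1) and w = N + 2 s + 1, so that w - e / 2 = N +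
      s.\<close>
    have *: "Y / T - e\<^sup>2 / (2 * w) * (Y / T / e) = Y * (w - e / 2) / (T * w)"
      if "e \<noteq> 0" "w \<noteq> 0" for e w
      using that T by (simp add: field_simps power2_eq_square)
    have **: "2 * real (Suc s) \<noteq> 0" "N + 2 * real s + 1 \<noteq> 0"
      "N + 2 * real s + 1 - 2 * real (Suc s) / 2 = N + real s"
      using N by (simp_all add: field_simps)
    show ?thesis
      unfolding *[OF **(1,2)] **(3) ..
  qed
  ultimately show ?thesis
    by (simp only: c)
qed

text \<open>The arithmetic of the norm recursion from the even to the odd family at the same s. The
  first term is the harmonic norm for the factor u P of degree k + 1.\<close>

lemma fischer_c_Suc:
  assumes "p + q > 0"
  shows "fischer_c (Suc s) k i p q / (2 * real (Suc s)) = real (p + 2 * k) * fischer_c s (Suc k) i p q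
    - (real (p + 2 * s + 2 * k))\<^sup>2 / (2 * real (2 * s + 1 + k + i) + real (p + q) - 2) * fischer_a s k i p q"
proof -
  define K where "K = real k + real p / 2"
  define I where "I = real i + real q / 2"
  define Z where "Z = 4 ^ s * fact s * pochhammer I s"
  define T where "T = pochhammer (K + I + real s) s"
  have "real (p + q) > 0"
    using assms by (simp only: of_nat_0_less_iff)
  then have KI: "K + I > 0" "real k + real i + real (p + q) / 2 = K + I" "real (p + q) = real p + real q"
    unfolding K_def I_def by (linarith, simp_all add: add_divide_distrib)
  have T: "T \<noteq> 0"
    using pochhammer_pos[of "K + I + real s" s] KI by (simp add: T_def)
  have a: "fischer_a s k i p q = Z * pochhammer K s / T"
    using KI by (simp add: fischer_a_def K_def I_def Z_def T_def algebra_simps add_divide_distrib)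
  have "real s + real (Suc k) + real i + (real (p + q) - 2) / 2 = K + I + real s"
    by (simp add: K_def I_def field_simps)
  moreover have "real (Suc k) + real p / 2 = K + 1"
    by (simp add: K_def)
  ultimately have c: "fischer_c s (Suc k) i p q = Z * pochhammer (K + 1) s / T"
    unfolding fischer_c_def by (simp only: I_def[symmetric]) (simp add: Z_def T_def)
  have "real (Suc s) + real k + real i + (real (p + q) - 2) / 2 = K + I + real s"
    by (simp add: K_def I_def field_simps)
  then have "fischer_c (Suc s) k i p q
      = 4 ^ Suc s * fact (Suc s) * (pochhammer K (Suc s) * pochhammer I (Suc s) / pochhammer (K + I + real s) (Suc s))"
    unfolding fischer_c_def by (simp only: I_def K_def)
  also have "\<dots> = 2 * real (Suc s) * (2 * Z * pochhammer K s * (K + real s) * (I + real s) / (T * (K + I + 2 * real s)))"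
    by (simp add: pochhammer_Suc Z_def T_def algebra_simps)
  finally have c': "fischer_c (Suc s) k i p q / (2 * real (Suc s))
      = 2 * Z * pochhammer K s * (K + real s) * (I + real s) / (T * (K + I + 2 * real s))"
    by (simp only: nonzero_mult_div_cancel_left) simp
  have p: "K * pochhammer (K + 1) s = pochhammer K s * (K + real s)"
    using pochhammer_rec[of K s] pochhammer_Suc[of K s] by simp
  have D: "2 * real (2 * s + 1 + k + i) + real (p + q) - 2 = 2 * (K + I + 2 * real s)"
    "real (p + 2 * s + 2 * k) = 2 * (K + real s)" "real (p + 2 * k) = 2 * K"
    by (simp_all add: K_def I_def)
  have "2 * K * (Z * pochhammer (K + 1) s / T) = 2 * Z * (K * pochhammer (K + 1) s) / T"
    by simp
  also have "\<dots> = 2 * Z * (pochhammer K s * (K + real s)) / T"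
    by (simp only: p)
  finally have e: "2 * K * (Z * pochhammer (K + 1) s / T) = 2 * Z * (pochhammer K s * (K + real s)) / T" .
  \<comment> \<open>Used with w = K + I + 2 s and y = K + s, so that w - y = I + s.\<close>
  have "2 * z * y * (w - y) / (T * w) = 2 * (z * y) / T - (2 * y)\<^sup>2 / (2 * w) * (z / T)"
    if "w \<noteq> 0" for w y z
    using that T by (simp add: field_simps power2_eq_square)
  from this[of "K + I + 2 * real s" "Z * pochhammer K s" "K + real s"]
  have "2 * Z * pochhammer K s * (K + real s) * (I + real s) / (T * (K + I + 2 * real s))
      = 2 * Z * (pochhammer K s * (K + real s)) / T
        - (2 * (K + real s))\<^sup>2 / (2 * (K + I + 2 * real s)) * (Z * pochhammer K s / T)"
    using KI by (simp add: mult.assoc)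
  then show ?thesis
    by (simp only: c' c a D e)
qed

text \<open>For s = 0 numerator and denominator coincide, and the hypothesis keeps them nonzero. For
  s > 0 the claim simplifies \<open>fischer_a_Suc\<close>.\<close>

lemma fischer_a_eq:
  assumes "p + q > 0" "2 * (2 * s + k + i) + (p + q) \<noteq> 2"
  shows "fischer_a s k i p q = (2 * (real s + real k + real i) + real (p + q) - 2)
    / (2 * (2 * real s + real k + real i) + real (p + q) - 2) * fischer_c s k i p q"
proof (cases s)
  case 0
  have "real (2 * (k + i) + (p + q)) \<noteq> real 2"
    using assms(2) 0 by (simp only: of_nat_eq_iff) simp
  then have "2 * (real k + real i) + real (p + q) - 2 \<noteq> 0"
    by simp
  with 0 show ?thesis
    by (simp add: fischer_a_def fischer_c_def)
next
  case (Suc t)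
  define x where "x = 2 * real (2 * Suc t + k + i) + real (p + q) - 2"
  have "x \<noteq> 0"
    using assms(1) by (simp add: x_def)
  then have "c - e\<^sup>2 / x * (c / e) = (x - e) / x * c" if "e \<noteq> 0" for c e
    using that by (simp add: field_simps power2_eq_square)
  from this[of "2 * real (Suc t)" "fischer_c (Suc t) k i p q"]
  have "fischer_a (Suc t) k i p q = (x - 2 * real (Suc t)) / x * fischer_c (Suc t) k i p q"
    unfolding fischer_a_Suc[OF assms(1)] x_def[symmetric] by simp
  moreover have "x = 2 * (2 * real s + real k + real i) + real (p + q) - 2"
    "x - 2 * real (Suc t) = 2 * (real s + real k + real i) + real (p + q) - 2"
    by (simp_all add: x_def Suc)
  ultimately show ?thesis
    by (simp only: Suc)
qed

section \<open>The two families built from a pair of monogenic factors\<close>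

locale monogenic_split = orthogonal_split +
  fixes P Q :: cpoly and k i :: nat
  assumes forms_P: "P \<in> forms k U" and dirac_P: "dirac U P = 0"
    and forms_Q: "Q \<in> forms i V" and dirac_Q: "dirac V Q = 0"
begin

lemma cpoly_on_P: "P \<in> cpoly_on U" and cpoly_on_Q: "Q \<in> cpoly_on V"
  using forms_P forms_Q by (simp_all add: forms_def)

lemma forms_even: "norm_sq U ^ s * P * Q \<in> forms (2 * s + k + i) (U \<union> V)"
  by (intro forms_mult_Un forms_norm_sq_power_mult forms_P forms_Q)

lemma forms_odd: "norm_sq U ^ s * (vec U * P) * Q \<in> forms (2 * s + 1 + k + i) (U \<union> V)"
  using forms_mult_Un[OF forms_norm_sq_power_mult[OF forms_vec_mult[OF forms_P]] forms_Q]
  by simp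

lemma dirac_mult_Q:
  assumes "R \<in> forms l U"
  shows "dirac (U \<union> V) (R * Q) = dirac U R * Q"
  using assms dirac_mult_left[OF cpoly_on_Q disjoint, of R] dirac_mult_right[of R U V Q] disjoint dirac_Q
  by (simp add: dirac_Un forms_def)

lemma dirac_even:
  "dirac (U \<union> V) (norm_sq U ^ s * P * Q) = cscale (2 * of_nat s) (norm_sq U ^ (s - 1) * (vec U * P) * Q)"
  by (simp add: dirac_mult_Q[OF forms_norm_sq_power_mult[OF forms_P]]
      dirac_norm_sq_power_mult[OF finite_U] dirac_P cscale_mult_left)

text \<open>Differentiating |u|^(2s) contributes -2 s because u u = -|u|^2, and differentiating u P
  contributes -(p + 2 k).\<close>

lemma dirac_odd:
  "dirac (U \<union> V) (norm_sq U ^ s * (vec U * P) * Q)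
    = cscale (- of_nat (card U + 2 * s + 2 * k)) (norm_sq U ^ s * P * Q)"
proof -
  have "norm_sq U ^ (s - 1) * (vec U * (vec U * P)) = - (norm_sq U ^ s * P)" if "s > 0"
    using that by (cases s) (simp_all add: vec_vec mult.assoc[symmetric] power_commutes)
  then have "dirac U (norm_sq U ^ s * (vec U * P))
      = cscale (- (2 * of_nat s)) (norm_sq U ^ s * P) - cscale (of_nat (card U + 2 * k)) (norm_sq U ^ s * P)"
    unfolding dirac_norm_sq_power_mult[OF finite_U] dirac_vec_monogenic[OF finite_U forms_P dirac_P]
    by (cases "s > 0") (simp_all add: cscale_mult_right)
  also have "\<dots> = cscale (- of_nat (card U + 2 * s + 2 * k)) (norm_sq U ^ s * P)"
    unfolding cpoly.scale_left_diff_distrib[symmetric] by (rule arg_cong2[of _ _ _ _ cscale]) simp_all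
  finally show ?thesis
    by (simp only: dirac_mult_Q[OF forms_norm_sq_power_mult[OF forms_vec_mult[OF forms_P]]] cscale_mult_left)
qed

text \<open>The recursion alternates: the even case at s refers to the odd case at s - 1, and the
  odd case at s to the even case at s.\<close>

lemma fischer_norm_sq_proj_M_split:
  assumes "U \<union> V \<noteq> {}"
  shows "fischer_norm_sq (proj_M (U \<union> V) (norm_sq U ^ s * P * Q))
      = of_real (fischer_a s k i (card U) (card V)) * fischer_norm_sq P * fischer_norm_sq Q"
    (is "?even s")
    and "fischer_norm_sq (proj_M (U \<union> V) (norm_sq U ^ s * (vec U * P) * Q))
      = of_real (fischer_c (Suc s) k i (card U) (card V) / (2 * real (Suc s)))
        * fischer_norm_sq P * fischer_norm_sq Q" (is "?odd s")
proof -
  let ?p = "card U" and ?q = "card V"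
  define X where "X = U \<union> V"
  have X: "finite X" "card X = ?p + ?q" "?p + ?q > 0"
    using assms finite_U finite_V card_Un by (auto simp: X_def card_gt_0_iff)
  have Q: "laplace V Q = 0" and P: "laplace U P = 0" "laplace U (vec U * P) = 0"
    using dirac_P dirac_Q laplace_monogenic laplace_vec_monogenic[OF finite_U forms_P] by auto
  have even: "fischer_norm_sq (proj_M X (norm_sq U ^ s * P * Q))
      = of_real (fischer_c s k i ?p ?q) * fischer_norm_sq P * fischer_norm_sq Q
      - of_real ((2 * real s)\<^sup>2 / (2 * real (2 * s + k + i) + real (?p + ?q) - 2))
        * fischer_norm_sq (proj_M X (norm_sq U ^ (s - 1) * (vec U * P) * Q))" for s
    using fischer_norm_sq_proj_M_if_dirac_eq[OF finite_Un forms_even forms_odd[of "s - 1"], of s "2 * real s"]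
      fischer_norm_sq_proj_H_split[OF assms forms_P P(1) forms_Q Q, of s] dirac_even[of s]
    by (simp add: X_def card_Un)
  have odd: "fischer_norm_sq (proj_M X (norm_sq U ^ s * (vec U * P) * Q))
      = of_real (real (?p + 2 * k) * fischer_c s (Suc k) i ?p ?q) * fischer_norm_sq P * fischer_norm_sq Q
      - of_real ((real (?p + 2 * s + 2 * k))\<^sup>2 / (2 * real (2 * s + 1 + k + i) + real (?p + ?q) - 2))
        * fischer_norm_sq (proj_M X (norm_sq U ^ s * P * Q))" for s
  proof -
    have "dirac X (norm_sq U ^ s * (vec U * P) * Q)
        = cscale (of_real (- real (?p + 2 * s + 2 * k))) (norm_sq U ^ s * P * Q)"
      by (simp only: X_def dirac_odd of_real_minus of_real_of_nat_eq)
    note fischer_norm_sq_proj_M_if_dirac_eq[OF finite_Un forms_odd forms_even this[unfolded X_def]]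
    moreover have "fischer_norm_sq (proj_H X (norm_sq U ^ s * (vec U * P) * Q))
        = of_real (real (?p + 2 * k) * fischer_c s (Suc k) i ?p ?q) * fischer_norm_sq P * fischer_norm_sq Q"
      using fischer_norm_sq_proj_H_split[OF assms forms_vec_mult[OF forms_P] P(2) forms_Q Q, of s]
        fischer_norm_sq_vec_monogenic[OF finite_U forms_P dirac_P]
      by (simp add: X_def)
    ultimately show ?thesis
      by (simp only: X_def card_Un power2_minus)
  qed
  have odd_if_even: "?odd s" if "?even s" for s
    using that odd[of s] fischer_c_Suc[OF X(3), of s k i]
    by (simp only: X_def) (simp add: algebra_simps)
  have "?even s \<and> ?odd s" for s
  proof (induction s)
    case 0
    \<comment> \<open>At s = 0 the Dirac derivative is zero, and \<open>fischer_a\<close> and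
      \<open>fischer_c\<close> are both 1.\<close>
    have "?even 0"
      using even[of 0] by (simp add: X_def fischer_a_def fischer_c_def)
    then show ?case
      using odd_if_even by blast
  next
    case (Suc s)
    then have "?even (Suc s)"
      using even[of "Suc s"] fischer_a_Suc[OF X(3), of s k i]
      by (simp only: X_def diff_Suc_1) (simp add: algebra_simps)
    then show ?case
      using odd_if_even by blast
  qed
  then show "?even s" "?odd s"
    by blast+
qed

section \<open>The projection formulas for both families\<close>

lemma cpoly_inv_P_vec: "cpoly_inv P * vec V = vec V * P"
  using vec_mult_cpoly_on[OF cpoly_on_P disjoint] by simp

lemma vec_V_vec_U: "vec V * vec U = - (vec U * vec V)"
proof -
  have "vec U \<in> cpoly_on U"
    using forms_vec[of U] by (simp add: forms_def)
  then show ?thesis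
    using vec_mult_cpoly_on[of "vec U" U V] disjoint by (simp add: cpoly_inv_vec)
qed

lemma forms_mixed: "norm_sq U ^ s * cpoly_inv P * vec V * Q \<in> forms (2 * s + 1 + k + i) (U \<union> V)"
  using forms_mult_Un[OF forms_norm_sq_power_mult[OF forms_cpoly_inv[OF forms_P]] forms_vec_mult[OF forms_Q], of s]
  by (simp add: mult.assoc)

text \<open>With e = p + 2 s + 2 k one has x\<partial>f = -e (f + g): the u part of x restores f,
  and the v part yields g after v P = P' v. Dividing by D and projecting gives the formula.\<close>

lemma proj_M_odd:
  "proj_M (U \<union> V) (vec U * norm_sq U ^ s * P * Q) =
    cscale (1 / (2 * (2 * real s + 1 + real k + real i) + real (card U + card V) - 2))
      (cscale (2 * real s + real (card V) + 2 * real i) (proj_H (U \<union> V) (norm_sq U ^ s * vec U * P * Q))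
       - cscale (real (card U) + 2 * real s + 2 * real k)
           (proj_H (U \<union> V) (norm_sq U ^ s * cpoly_inv P * vec V * Q)))"
proof -
  let ?X = "U \<union> V"
  define n where "n = 2 * s + 1 + k + i"
  define f where "f = norm_sq U ^ s * (vec U * P) * Q"
  define g where "g = norm_sq U ^ s * cpoly_inv P * vec V * Q"
  define D where "D = 2 * real n + real (card ?X) - 2"
  define e where "e = real (card U) + 2 * real s + 2 * real k"
  have f: "f \<in> forms n ?X" and g: "g \<in> forms n ?X"
    using forms_odd forms_mixed by (simp_all add: f_def g_def n_def)
  have "vec ?X * dirac ?X f = cscale (- e) (vec U * (norm_sq U ^ s * P * Q) + vec V * (norm_sq U ^ s * P * Q))"
    unfolding f_def dirac_odd by (simp add: cscale_mult_right vec_Un distrib_right e_def algebra_simps)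
  also have "vec U * (norm_sq U ^ s * P * Q) = f"
    unfolding f_def by (metis mult.assoc norm_sq_power_commute)
  also have "vec V * (norm_sq U ^ s * P * Q) = norm_sq U ^ s * (vec V * P) * Q"
    by (metis mult.assoc norm_sq_power_commute)
  also have "\<dots> = g"
    by (simp only: g_def cpoly_inv_P_vec[symmetric] mult.assoc)
  finally have M: "mproj ?X n f = f - cscale (1 / D * e) (f + g)"
    by (simp add: mproj_def D_def)
  have L: "vec U * norm_sq U ^ s * P * Q = f" "norm_sq U ^ s * vec U * P * Q = f"
    unfolding f_def by (simp_all add: mult.assoc) (metis mult.assoc norm_sq_power_commute)
  have c: "2 * (2 * real s + 1 + real k + real i) + real (card U + card V) - 2 = D"
    "2 * real s + real (card V) + 2 * real i = D - e"
    by (simp_all add: D_def e_def n_def card_Un)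
  have "proj_M ?X f = cscale (1 / D) (cscale (D - e) (proj_H ?X f) - cscale e (proj_H ?X g))"
  proof (cases "D = 0")
    \<comment> \<open>As the degree n is at least 1, D = 0 forces the space to be trivial; then u =
      0 and f = 0, and the right side is 0 because 1 / 0 = 0.\<close>
    case True
    then have "card U = 0"
      unfolding D_def n_def card_Un by simp
    then have "vec U = 0"
      using finite_U by (simp add: vec_def)
    then have "f = 0"
      by (simp add: f_def)
    moreover have "proj_M ?X 0 = 0"
      by (rule proj_M_0[OF finite_Un])
    ultimately show ?thesis
      using True by simp
  next
    case False
    then have "complex_of_real D \<noteq> 0"
      by simp
    then have "mproj ?X n f = cscale (1 / D) (cscale (D - e) f - cscale e g)"
      unfolding M by (simp add: cpoly.scale_right_distrib cpoly.scale_right_diff_distrib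
          cpoly.scale_left_diff_distrib diff_divide_distrib)
    then show ?thesis
      by (simp only: proj_M_eq_proj_H[OF finite_Un f] proj_H_lincomb[OF finite_Un f g])
  qed
  then show ?thesis
    by (simp only: L c g_def e_def)
qed

text \<open>Again x\<partial>f = -e (f + g), now with e = 2 s: u u = -|u|^2 yields -f, and v u = -u
  v followed by v P = P' v yields -g.\<close>

lemma proj_M_even:
  assumes "2 * (2 * s + k + i) + (card U + card V) \<noteq> 2"
  shows "proj_M (U \<union> V) (norm_sq U ^ s * P * Q) =
    cscale (1 / (2 * (2 * real s + real k + real i) + real (card U + card V) - 2))
      (cscale (2 * (real s + real k + real i) + real (card U + card V) - 2)
         (proj_H (U \<union> V) (norm_sq U ^ s * P * Q))
       - cscale (2 * real s)
           (proj_H (U \<union> V) (norm_sq U ^ (s - 1) * vec U * cpoly_inv P * vec V * Q)))"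
proof -
  let ?X = "U \<union> V"
  define n where "n = 2 * s + k + i"
  define f where "f = norm_sq U ^ s * P * Q"
  define g where "g = norm_sq U ^ (s - 1) * vec U * cpoly_inv P * vec V * Q"
  define D where "D = 2 * real n + real (card ?X) - 2"
  define e where "e = 2 * real s"
  have f: "f \<in> forms n ?X"
    using forms_even by (simp add: f_def n_def)
  have c: "2 * (2 * real s + real k + real i) + real (card U + card V) - 2 = D"
    "2 * (real s + real k + real i) + real (card U + card V) - 2 = D - e"
    by (simp_all add: D_def e_def n_def card_Un)
  have "real (2 * (2 * s + k + i) + (card U + card V)) \<noteq> real 2"
    using assms by (metis of_nat_eq_iff)
  then have "D \<noteq> 0"
    unfolding c(1)[symmetric] by simp
  then have D: "complex_of_real D \<noteq> 0"
    by simp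
  have "proj_M ?X f = cscale (1 / D) (cscale (D - e) (proj_H ?X f) - cscale e (proj_H ?X g))"
  proof (cases s)
    \<comment> \<open>Here f is monogenic, so \<open>mproj\<close> fixes it; the coefficient e = 0
      removes the second term.\<close>
    case 0
    then have "dirac ?X f = 0"
      using dirac_even[of 0] by (simp add: f_def)
    with 0 D show ?thesis
      unfolding proj_M_eq_proj_H[OF finite_Un f] by (simp add: mproj_def e_def)
  next
    case (Suc t)
    have "norm_sq U ^ t * (vec U * cpoly_inv P) \<in> forms (2 * t + Suc k) U"
      by (intro forms_norm_sq_power_mult forms_vec_mult forms_cpoly_inv forms_P)
    from forms_mult_Un[OF this forms_vec_mult[OF forms_Q]] have g: "g \<in> forms n ?X"
      by (simp add: g_def n_def Suc mult.assoc)
    have U: "vec U * (norm_sq U ^ t * (vec U * P) * Q) = - f"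
    proof -
      have "vec U * (norm_sq U ^ t * (vec U * P) * Q) = vec U * vec U * (norm_sq U ^ t * P * Q)"
        by (metis mult.assoc norm_sq_power_commute)
      then show ?thesis
        by (simp add: vec_vec f_def Suc mult.assoc)
    qed
    have V: "vec V * (norm_sq U ^ t * (vec U * P) * Q) = - g"
    proof -
      have "vec V * (norm_sq U ^ t * (vec U * P) * Q) = norm_sq U ^ t * (vec V * vec U) * P * Q"
        by (metis mult.assoc norm_sq_power_commute)
      also have "\<dots> = - (norm_sq U ^ t * vec U * (vec V * P) * Q)"
        by (simp add: vec_V_vec_U mult.assoc)
      also have "\<dots> = - g"
        by (simp only: g_def Suc diff_Suc_1 cpoly_inv_P_vec[symmetric] mult.assoc)
      finally show ?thesis .
    qed
    have "vec ?X * dirac ?X f = cscale e (vec U * (norm_sq U ^ t * (vec U * P) * Q)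
        + vec V * (norm_sq U ^ t * (vec U * P) * Q))"
      using dirac_even[of s] by (simp add: f_def e_def Suc cscale_mult_right vec_Un distrib_right)
    then have "mproj ?X n f = f - cscale (1 / D * e) (f + g)"
      unfolding U V by (simp add: mproj_def D_def cpoly.scale_right_distrib cpoly.scale_right_diff_distrib)
    then have "mproj ?X n f = cscale (1 / D) (cscale (D - e) f - cscale e g)"
      using D by (simp add: cpoly.scale_right_distrib cpoly.scale_right_diff_distrib
          cpoly.scale_left_diff_distrib diff_divide_distrib)
    then show ?thesis
      by (simp only: proj_M_eq_proj_H[OF finite_Un f] proj_H_lincomb[OF finite_Un f g])
  qed
  then show ?thesis
    by (simp only: c f_def g_def e_def)
qed

end

lemma forms_empty: "P \<in> forms k {} \<Longrightarrow> k > 0 \<Longrightarrow> P = 0"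
  unfolding forms_def homogeneous_iff cpoly_on_iff
  by (intro poly_mapping_eqI) (auto simp: mdeg_def)

text \<open>The even formulas exclude a zero denominator, where 1 / 0 = 0 would make the right sides
  0. In the odd projection formula the denominator vanishes only for m = s = k = i = 0, and there
  both sides are 0.\<close>

theorem theorem9:
  fixes p q s k i :: nat and P Q :: cpoly
  defines "m \<equiv> p + q"
    and "U \<equiv> {1..p}" and "V \<equiv> {p + 1..p + q}" and "X \<equiv> {1..p + q}"
  assumes "P \<in> monogenics_deg k U" and "Q \<in> monogenics_deg i V"
  shows
    "(2 * (2 * s + k + i) + m \<noteq> 2 \<longrightarrow>
        proj_M X (norm_sq U ^ s * P * Q) =
          cscale (1 / (2 * (2 * real s + real k + real i) + real m - 2))
            (cscale (2 * (real s + real k + real i) + real m - 2)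
               (proj_H X (norm_sq U ^ s * P * Q))
             - cscale (2 * real s)
               (proj_H X (norm_sq U ^ (s - 1) * vec U * cpoly_inv P * vec V * Q))))
     \<and>
     proj_M X (vec U * norm_sq U ^ s * P * Q) =
       cscale (1 / (2 * (2 * real s + 1 + real k + real i) + real m - 2))
         (cscale (2 * real s + real m - real p + 2 * real i)
            (proj_H X (norm_sq U ^ s * vec U * P * Q))
          - cscale (real p + 2 * real s + 2 * real k)
            (proj_H X (norm_sq U ^ s * cpoly_inv P * vec V * Q)))
     \<and>
     (2 * (2 * s + k + i) + m \<noteq> 2 \<longrightarrow>
        fischer_norm_sq (proj_M X (norm_sq U ^ s * P * Q)) =
          (2 * (real s + real k + real i) + real m - 2)
            / (2 * (2 * real s + real k + real i) + real m - 2)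
          * fischer_c s k i p q * fischer_norm_sq P * fischer_norm_sq Q)
     \<and>
     fischer_norm_sq (proj_M X (vec U * norm_sq U ^ s * P * Q)) =
       fischer_c (s + 1) k i p q / (2 * (real s + 1))
         * fischer_norm_sq P * fischer_norm_sq Q"
proof -
  interpret monogenic_split U V P Q k i
    using assms(5,6)
    by unfold_locales (auto simp: U_def V_def monogenics_deg_def monogenics_def forms_def)
  have X: "X = U \<union> V" and card: "card U = p" "card V = q"
    by (auto simp: X_def U_def V_def)
  have odd: "vec U * norm_sq U ^ s * P * Q = norm_sq U ^ s * (vec U * P) * Q"
    by (metis mult.assoc norm_sq_power_commute)
  have norms: "(2 * (2 * s + k + i) + m \<noteq> 2 \<longrightarrow>
        fischer_norm_sq (proj_M X (norm_sq U ^ s * P * Q)) =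
          of_real ((2 * (real s + real k + real i) + real m - 2)
            / (2 * (2 * real s + real k + real i) + real m - 2)
          * fischer_c s k i p q) * fischer_norm_sq P * fischer_norm_sq Q)
     \<and> fischer_norm_sq (proj_M X (vec U * norm_sq U ^ s * P * Q)) =
       of_real (fischer_c (s + 1) k i p q / (2 * (real s + 1)))
         * fischer_norm_sq P * fischer_norm_sq Q"
  proof (cases "m = 0")
    case False
    then have "U \<union> V \<noteq> {}" "p + q > 0"
      by (auto simp: U_def V_def m_def)
    note norms = fischer_norm_sq_proj_M_split[OF this(1), of s, folded X, unfolded card]
    show ?thesis
    proof (intro conjI impI)
      assume "2 * (2 * s + k + i) + m \<noteq> 2"
      then have "fischer_a s k i p q = (2 * (real s + real k + real i) + real m - 2)
          / (2 * (2 * real s + real k + real i) + real m - 2) * fischer_c s k i p q"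
        unfolding m_def by (rule fischer_a_eq[OF \<open>p + q > 0\<close>])
      then show "fischer_norm_sq (proj_M X (norm_sq U ^ s * P * Q)) =
          of_real ((2 * (real s + real k + real i) + real m - 2)
            / (2 * (2 * real s + real k + real i) + real m - 2)
          * fischer_c s k i p q) * fischer_norm_sq P * fischer_norm_sq Q"
        using norms(1) by (simp only:)
    next
      show "fischer_norm_sq (proj_M X (vec U * norm_sq U ^ s * P * Q)) =
          of_real (fischer_c (s + 1) k i p q / (2 * (real s + 1))) * fischer_norm_sq P * fischer_norm_sq Q"
        unfolding odd norms(2) by (simp add: add.commute)
    qed
  next
    \<comment> \<open>For m = 0 there are no variables: u and |u|^2 are 0, and every polynomial is a
      constant and monogenic.\<close>
    case True
    then have pq: "p = 0" "q = 0" and UV: "U = {}" "V = {}" "X = {}"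
      by (auto simp: U_def V_def X_def m_def)
    have PQ: "P * Q \<in> forms (k + i) {}"
      using forms_mult_Un[OF forms_P forms_Q] by (simp add: UV)
    then have "proj_M {} (P * Q) = P * Q"
      using proj_M_add_vec_mult[OF _ _ forms_0[of 0 "{}"], of "P * Q"] by (simp add: monogenics_def forms_def dirac_def)
    moreover have "fischer_norm_sq (P * Q) = fischer_norm_sq P * fischer_norm_sq Q"
      by (rule fischer_inner_mult_disjoint[OF cpoly_on_P cpoly_on_P cpoly_on_Q cpoly_on_Q disjoint])
    ultimately have PQ: "fischer_norm_sq (proj_M {} (P * Q)) = fischer_norm_sq P * fischer_norm_sq Q"
      by simp
    \<comment> \<open>For k > 0 there is no nonzero P; for k = 0 the rising factorial starting at 0
      vanishes.\<close>
    have c: "complex_of_real (fischer_c (Suc t) k i 0 0) * fischer_norm_sq P = 0" for t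
      using forms_empty[of P k] forms_P by (cases "k = 0") (auto simp: fischer_c_def pochhammer_rec UV)
    have zero: "norm_sq {} = 0" "vec {} = 0" "proj_M {} 0 = 0"
      by (simp_all add: norm_sq_def vec_def proj_M_0)
    have odd_0: "complex_of_real (fischer_c (Suc s) k i 0 0 / (2 * (real s + 1))) * fischer_norm_sq P = 0"
      using c[of s] by auto
    show ?thesis
    proof (cases s)
      case 0
      \<comment> \<open>At s = 0 the prefactor is a quotient of equal nonzero numbers, hence
        1.\<close>
      have "2 * (real k + real i) - 2 \<noteq> 0" if "2 * (k + i) \<noteq> 2"
      proof -
        have "real (2 * (k + i)) \<noteq> real 2"
          using that by (metis of_nat_eq_iff)
        then show ?thesis by simp
      qed
      with 0 PQ odd_0 show ?thesis
        by (auto simp: UV m_def pq zero fischer_c_def)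
    next
      case (Suc t)
      with c[of t] odd_0 show ?thesis
        by (auto simp: UV m_def pq zero)
    qed
  qed
  have even_formula: "2 * (2 * s + k + i) + m \<noteq> 2 \<longrightarrow>
        proj_M X (norm_sq U ^ s * P * Q) =
          cscale (1 / (2 * (2 * real s + real k + real i) + real m - 2))
            (cscale (2 * (real s + real k + real i) + real m - 2)
               (proj_H X (norm_sq U ^ s * P * Q))
             - cscale (2 * real s)
               (proj_H X (norm_sq U ^ (s - 1) * vec U * cpoly_inv P * vec V * Q)))"
    unfolding m_def using proj_M_even[of s, folded X, unfolded card] by blast
  have "2 * real s + real m - real p + 2 * real i = 2 * real s + real q + 2 * real i"
    by (simp add: m_def)
  then have odd_formula: "proj_M X (vec U * norm_sq U ^ s * P * Q) =
       cscale (1 / (2 * (2 * real s + 1 + real k + real i) + real m - 2))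
         (cscale (2 * real s + real m - real p + 2 * real i)
            (proj_H X (norm_sq U ^ s * vec U * P * Q))
          - cscale (real p + 2 * real s + 2 * real k)
            (proj_H X (norm_sq U ^ s * cpoly_inv P * vec V * Q)))"
    using proj_M_odd[of s, folded X, unfolded card] by (simp only: m_def)
  show ?thesis
    using even_formula odd_formula norms by blast
qed

end
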